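(* Let $v=C+Q'$ be as in the context. Let $\mathcal{F}:L^2([0,\pi])\to\ell^2(\mathbb{N})$ be the Fourier isomorphism $f\mapsto(f_k)_{k\in\mathbb{N}}$, $f_k=(f,\sqrt2\sin kx)$. Let $\mathcal{L}_d$ be the operator in $\ell^2(\mathbb{N})$ defined by $$\mathcal{L}_d(z)=(h_k(z))_{k\in\mathbb{N}},\qquad h_k(z)=k^2z_k+\frac1{\sqrt2}\sum_{m\in\mathbb{N}}\big(\tilde V(|k-m|)-\tilde V(k+m)\big)z_m+Cz_k,$$ on the domain $D(\mathcal{L}_d)=\{z\in\ell^2(|k|,\mathbb{N}):\ \mathcal{L}_d(z)\in\ell^2(\mathbb{N})\}$, where $\ell^2(|k|,\mathbb{N})=\{z=(z_k)_{k\in\mathbb{N}}:\ \sum_k|k|^2|z_k|^2<\infty\}$. Then $D(L_{Dir})=\mathcal{F}^{-1}(D(\mathcal{L}_d))$ and $L_{Dir}=\mathcal{F}^{-1}\circ\mathcal{L}_d\circ\mathcal{F}$.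
   Context: $v\in H^{-1}_{loc}(\mathbb{R})$ is a $\pi$-periodic distribution written (uniquely) as $v=C+Q'$ with $C\in\mathbb{C}$ and $Q\in L^2_{loc}(\mathbb{R})$ $\pi$-periodic with $\int_0^\pi Q=0$. Inner product on $L^2([0,\pi])$: $(f,g)=\frac1\pi\int_0^\pi f\overline g$. $Q\sim\sum_{k\ge1}\tilde q(k)\sqrt2\sin kx$ is the sine expansion of $Q$ on $[0,\pi]$; $\tilde V(0)=0$, $\tilde V(k)=k\tilde q(k)$ for $k\in\mathbb{N}$. $\ell(y)=-(y'-Qy)'-Qy'+Cy$. $L_{Dir}$ is the operator $y\mapsto\ell(y)$ in $L^2([0,\pi])$ with domain $\{y\in H^1([0,\pi]): y'-Qy\in W^1_1([0,\pi]),\ y(0)=y(\pi)=0,\ \ell(y)\in L^2([0,\pi])\}$, $W^1_1$ denoting absolutely continuous functions. *)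

theory Defs
  imports "HOL-Analysis.Analysis"
begin

definition L2_on :: "(real \<Rightarrow> complex) \<Rightarrow> bool" where
  "L2_on f \<longleftrightarrow> set_borel_measurable lborel {0..pi} f \<and>
     set_integrable lborel {0..pi} (\<lambda>x. (cmod (f x))\<^sup>2)"

definition ip :: "(real \<Rightarrow> complex) \<Rightarrow> (real \<Rightarrow> complex) \<Rightarrow> complex" where
  "ip f g = complex_of_real (1 / pi) * (LINT x:{0..pi}|lborel. f x * cnj (g x))"

text \<open>Fourier isomorphism: f_k = (f, sqrt 2 sin kx); index 0 is unused (and equals 0).\<close>
definition fourier :: "(real \<Rightarrow> complex) \<Rightarrow> nat \<Rightarrow> complex" where
  "fourier f k = ip f (\<lambda>x. complex_of_real (sqrt 2 * sin (real k * x)))"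

definition qt :: "(real \<Rightarrow> complex) \<Rightarrow> nat \<Rightarrow> complex" where
  "qt Q k = fourier Q k"

definition Vt :: "(real \<Rightarrow> complex) \<Rightarrow> nat \<Rightarrow> complex" where
  "Vt Q n = (if n = 0 then 0 else of_nat n * qt Q n)"

definition absdiff :: "nat \<Rightarrow> nat \<Rightarrow> nat" where
  "absdiff k m = (if m \<le> k then k - m else m - k)"

text \<open>Sequence spaces on N = {1,2,...} (index 0 is ignored by the weights / is zero).\<close>
definition l2 :: "(nat \<Rightarrow> complex) \<Rightarrow> bool" where
  "l2 z \<longleftrightarrow> summable (\<lambda>k. (cmod (z (Suc k)))\<^sup>2)"

definition l2k :: "(nat \<Rightarrow> complex) \<Rightarrow> bool" where
  "l2k z \<longleftrightarrow> summable (\<lambda>k. (real k)\<^sup>2 * (cmod (z k))\<^sup>2)"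

definition Ld_term :: "(real \<Rightarrow> complex) \<Rightarrow> (nat \<Rightarrow> complex) \<Rightarrow> nat \<Rightarrow> nat \<Rightarrow> complex" where
  "Ld_term Q z k m = (Vt Q (absdiff k m) - Vt Q (k + m)) * z m"

definition Ld :: "(real \<Rightarrow> complex) \<Rightarrow> complex \<Rightarrow> (nat \<Rightarrow> complex) \<Rightarrow> nat \<Rightarrow> complex" where
  "Ld Q C z k = (if k = 0 then 0 else
     of_nat (k\<^sup>2) * z k + complex_of_real (1 / sqrt 2) * (\<Sum>m. Ld_term Q z k (Suc m)) + C * z k)"

definition Ld_dom :: "(real \<Rightarrow> complex) \<Rightarrow> complex \<Rightarrow> (nat \<Rightarrow> complex) set" where
  "Ld_dom Q C = {z. l2k z \<and> (\<forall>k\<ge>1. summable (\<lambda>m. Ld_term Q z k (Suc m))) \<and> l2 (Ld Q C z)}"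

text \<open>Graph of L_Dir: y is in D(L_Dir) and f is (a representative of) l(y).
  H^1: y in L2, y(x) = y(0) + int_0^x g with g in L2 (g = y').
  W^1_1: u(x) = u(0) + int_0^x w with w in L1, u = y' - Q y a.e. (u = y^[1]).
  l(y) = -(y' - Q y)' - Q y' + C y = -w - Q g + C y a.e.\<close>
definition LDir_graph :: "(real \<Rightarrow> complex) \<Rightarrow> complex \<Rightarrow> (real \<Rightarrow> complex) \<Rightarrow> (real \<Rightarrow> complex) \<Rightarrow> bool" where
  "LDir_graph Q C y f \<longleftrightarrow>
     (\<exists>g u w.
        L2_on y \<and> L2_on g \<and> (\<forall>x\<in>{0..pi}. y x = y 0 + (LINT t:{0..x}|lborel. g t)) \<and>
        set_integrable lborel {0..pi} w \<and>
        (\<forall>x\<in>{0..pi}. u x = u 0 + (LINT t:{0..x}|lborel. w t)) \<and>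
        (AE x in lborel. x \<in> {0..pi} \<longrightarrow> g x - Q x * y x = u x) \<and>
        y 0 = 0 \<and> y pi = 0 \<and>
        L2_on f \<and>
        (AE x in lborel. x \<in> {0..pi} \<longrightarrow> f x = - w x - Q x * g x + C * y x))"

definition DDir :: "(real \<Rightarrow> complex) \<Rightarrow> complex \<Rightarrow> (real \<Rightarrow> complex) set" where
  "DDir Q C = {y. \<exists>f. LDir_graph Q C y f}"

end

theory Submission
  imports Defs
begin

text \<open>The idea is to test the equation \<open>\<ell>(y) = f\<close> against \<open>s(x) = \<surd>2 sin kx\<close>. Integrating by
  parts, \<open>\<pi> f\<^sub>k = \<integral> (y' - Qy) s' - \<integral> Q y' s + C \<integral> y s\<close>, and the terms in \<open>Q\<close> combine to \<open>- \<integral> Q (y s)'\<close>.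
  Expanding \<open>y\<close> in sines and \<open>y'\<close> in cosines turns this into the matrix entries, because
  \<open>2 sin mx sin kx = cos (k - m)x - cos (k + m)x\<close>.
  Conversely, for \<open>z\<close> in the domain of the matrix operator, Riesz--Fischer provides \<open>y'\<close> and \<open>f\<close>, and
  the same identity shows that \<open>y' - Qy\<close> minus a primitive of \<open>- f - Q y' + C y\<close> is orthogonal to all
  \<open>cos kx\<close> with \<open>k \<ge> 1\<close>, hence is constant almost everywhere.\<close>

section \<open>Square integrable functions\<close>

text \<open>The product Q y' is only integrable, so the \<open>L\<^sup>2\<close> theory yields no
  expansion of it. The factor Q is therefore moved to the test function: Q s and Q s' are square
  integrable because s and s' are bounded, and y' and y are the functions that get expanded. Neither
  of the two resulting series has the matrix entries as its terms; only their termwise sum does.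
  Once y is written as the primitive of y', the condition y(pi) = 0 says that y' has mean zero. This
  removes the cosine of index 0 and also cancels the boundary term that would disturb the relation
  between the k-th cosine coefficient of y' and k times the k-th sine coefficient of y. In the
  converse direction the test functions s' have mean zero and cannot see constants; the constant
  left over is the free initial value of the quasi-derivative y' - Qy.\<close>

definition square_integrable :: "'a measure \<Rightarrow> ('a \<Rightarrow> complex) \<Rightarrow> bool" where
  "square_integrable M f \<longleftrightarrow> f \<in> borel_measurable M \<and> integrable M (\<lambda>x. (cmod (f x))\<^sup>2)"

lemma square_integrable_measurable:
  "square_integrable M f \<Longrightarrow> f \<in> borel_measurable M"
  by (simp add: square_integrable_def)

lemma square_integrable_mult:
  assumes "square_integrable M f" "square_integrable M g"
  shows "integrable M (\<lambda>x. f x * g x)"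
proof (rule Bochner_Integration.integrable_bound)
  show "integrable M (\<lambda>x. (cmod (f x))\<^sup>2 + (cmod (g x))\<^sup>2)"
    using assms by (simp add: square_integrable_def)
  show "(\<lambda>x. f x * g x) \<in> borel_measurable M"
    using assms by (auto simp: square_integrable_def)
  show "AE x in M. norm (f x * g x) \<le> norm ((cmod (f x))\<^sup>2 + (cmod (g x))\<^sup>2)"
  proof (rule AE_I2)
    fix x
    have "2 * cmod (f x) * cmod (g x) \<le> (cmod (f x))\<^sup>2 + (cmod (g x))\<^sup>2"
      by (rule sum_squares_bound)
    moreover have "0 \<le> cmod (f x) * cmod (g x)" by simp
    ultimately have "cmod (f x) * cmod (g x) \<le> (cmod (f x))\<^sup>2 + (cmod (g x))\<^sup>2"
      by linarith
    thus "norm (f x * g x) \<le> norm ((cmod (f x))\<^sup>2 + (cmod (g x))\<^sup>2)"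
      by (simp add: norm_mult)
  qed
qed

lemma square_integrable_add:
  assumes "square_integrable M f" "square_integrable M g"
  shows "square_integrable M (\<lambda>x. f x + g x)"
  unfolding square_integrable_def
proof
  show "(\<lambda>x. f x + g x) \<in> borel_measurable M"
    using assms by (auto simp: square_integrable_def)
  show "integrable M (\<lambda>x. (cmod (f x + g x))\<^sup>2)"
  proof (rule Bochner_Integration.integrable_bound)
    show "integrable M (\<lambda>x. 2 * (cmod (f x))\<^sup>2 + 2 * (cmod (g x))\<^sup>2)"
      using assms by (simp add: square_integrable_def)
    show "(\<lambda>x. (cmod (f x + g x))\<^sup>2) \<in> borel_measurable M"
      using assms by (auto simp: square_integrable_def)
    show "AE x in M. norm ((cmod (f x + g x))\<^sup>2) \<le> norm (2 * (cmod (f x))\<^sup>2 + 2 * (cmod (g x))\<^sup>2)"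
    proof (rule AE_I2)
      fix x
      have "(cmod (f x + g x))\<^sup>2 \<le> (cmod (f x) + cmod (g x))\<^sup>2"
        by (intro power_mono norm_triangle_ineq) auto
      also have "\<dots> \<le> 2 * (cmod (f x))\<^sup>2 + 2 * (cmod (g x))\<^sup>2"
        using sum_squares_bound[of "cmod (f x)" "cmod (g x)"] by (simp add: power2_sum)
      finally show "norm ((cmod (f x + g x))\<^sup>2) \<le> norm (2 * (cmod (f x))\<^sup>2 + 2 * (cmod (g x))\<^sup>2)"
        by simp
    qed
  qed
qed

lemma square_integrable_bounded_mult:
  assumes "square_integrable M f" "b \<in> borel_measurable M" "\<And>x. x \<in> space M \<Longrightarrow> cmod (b x) \<le> B"
  shows "square_integrable M (\<lambda>x. b x * f x)"
  unfolding square_integrable_def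
proof
  show "(\<lambda>x. b x * f x) \<in> borel_measurable M"
    using assms by (auto simp: square_integrable_def)
  show "integrable M (\<lambda>x. (cmod (b x * f x))\<^sup>2)"
  proof (rule Bochner_Integration.integrable_bound)
    show "integrable M (\<lambda>x. B\<^sup>2 * (cmod (f x))\<^sup>2)"
      using assms by (simp add: square_integrable_def)
    show "(\<lambda>x. (cmod (b x * f x))\<^sup>2) \<in> borel_measurable M"
      using assms by (auto simp: square_integrable_def)
    show "AE x in M. norm ((cmod (b x * f x))\<^sup>2) \<le> norm (B\<^sup>2 * (cmod (f x))\<^sup>2)"
      using assms(3) by (intro AE_I2) (auto simp: norm_mult power_mult_distrib intro!: mult_right_mono power_mono)
  qed
qed

lemma square_integrable_cmult:
  "square_integrable M f \<Longrightarrow> square_integrable M (\<lambda>x. c * f x)"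
  by (rule square_integrable_bounded_mult[where B = "cmod c"]) auto

lemma square_integrable_zero: "square_integrable M (\<lambda>x. 0)"
  by (simp add: square_integrable_def)

lemma square_integrable_diff:
  assumes "square_integrable M f" "square_integrable M g"
  shows "square_integrable M (\<lambda>x. f x - g x)"
  using square_integrable_add[OF assms(1) square_integrable_cmult[OF assms(2), of "-1"]] by simp

lemma square_integrable_sum:
  assumes "\<And>i. i \<in> I \<Longrightarrow> square_integrable M (f i)"
  shows "square_integrable M (\<lambda>x. \<Sum>i\<in>I. f i x)"
  using assms
  by (induction I rule: infinite_finite_induct)
     (auto intro: square_integrable_add square_integrable_zero)

lemma (in finite_measure) square_integrable_bounded:
  assumes "f \<in> borel_measurable M" "\<And>x. x \<in> space M \<Longrightarrow> cmod (f x) \<le> B"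
  shows "square_integrable M f"
  using square_integrable_bounded_mult[of M "\<lambda>x. 1" f B] assms
  by (simp add: square_integrable_def)

lemma (in finite_measure) square_integrable_integrable:
  assumes "square_integrable M f"
  shows "integrable M f"
  using square_integrable_mult[OF assms square_integrable_bounded[of "\<lambda>x. 1" 1]] by simp

section \<open>Limits of pairings and completeness of the space of square integrable
  functions\<close>

lemma tendsto_integral_mult_L2:
  assumes d: "\<And>n. square_integrable M (d n)" and f: "square_integrable M f"
    and lim: "(\<lambda>n. \<integral>x. (cmod (d n x))\<^sup>2 \<partial>M) \<longlonglongrightarrow> 0"
  shows "(\<lambda>n. \<integral>x. d n x * f x \<partial>M) \<longlonglongrightarrow> 0"
proof (rule tendsto_norm_zero_cancel, rule LIMSEQ_I)
  fix r :: real assume r: "0 < r"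
  define A where "A = (\<integral>x. (cmod (f x))\<^sup>2 \<partial>M)"
  have A: "A \<ge> 0" by (simp add: A_def)
  \<comment> \<open>Weighted form of Cauchy-Schwarz: |d f| \<le> |d|^2 / t + t |f|^2. With this t
    the second term contributes at most r / 2, uniformly in n, and the first one tends to 0; the
    summand 1 covers \<open>A = 0\<close>.\<close>
  define t where "t = r / (2 * (A + 1))"
  have t: "t > 0" using r A by (simp add: t_def)
  have tA: "t * A < r / 2 + r / 4"
  proof -
    have "t * A \<le> t * (A + 1)" using t by simp
    also have "\<dots> = r / 2" using A by (simp add: t_def field_simps)
    finally show ?thesis using r by simp
  qed
  have "0 < t * r / 4" using t r by simp
  from LIMSEQ_D[OF lim this] obtain N where
    N: "\<And>n. n \<ge> N \<Longrightarrow> (\<integral>x. (cmod (d n x))\<^sup>2 \<partial>M) < t * r / 4" by auto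
  show "\<exists>N. \<forall>n\<ge>N. norm (norm (\<integral>x. d n x * f x \<partial>M) - 0) < r"
  proof (intro exI allI impI)
    fix n assume n: "n \<ge> N"
    have "norm (\<integral>x. d n x * f x \<partial>M) \<le> (\<integral>x. norm (d n x * f x) \<partial>M)"
      by (rule integral_norm_bound)
    also have "\<dots> \<le> (\<integral>x. (cmod (d n x))\<^sup>2 / t + t * (cmod (f x))\<^sup>2 \<partial>M)"
    proof (rule integral_mono)
      show "integrable M (\<lambda>x. norm (d n x * f x))"
        using square_integrable_mult[OF d f] by simp
      show "integrable M (\<lambda>x. (cmod (d n x))\<^sup>2 / t + t * (cmod (f x))\<^sup>2)"
        using d f by (simp add: square_integrable_def)
      fix x
      have "0 \<le> (cmod (d n x) - t * cmod (f x))\<^sup>2" by simp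
      hence "2 * t * (cmod (d n x) * cmod (f x)) \<le> (cmod (d n x))\<^sup>2 + t\<^sup>2 * (cmod (f x))\<^sup>2"
        by (simp add: power2_diff power_mult_distrib mult_ac)
      hence "2 * (cmod (d n x) * cmod (f x)) \<le> (cmod (d n x))\<^sup>2 / t + t * (cmod (f x))\<^sup>2"
        using t by (simp add: field_simps power2_eq_square)
      moreover have "0 \<le> cmod (d n x) * cmod (f x)" by simp
      ultimately show "norm (d n x * f x) \<le> (cmod (d n x))\<^sup>2 / t + t * (cmod (f x))\<^sup>2"
        unfolding norm_mult by linarith
    qed
    also have "\<dots> = (\<integral>x. (cmod (d n x))\<^sup>2 \<partial>M) / t + t * A"
      using d f by (simp add: square_integrable_def A_def)
    also have "\<dots> < r / 4 + (r / 2 + r / 4)"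
    proof (rule add_strict_mono)
      show "(\<integral>x. (cmod (d n x))\<^sup>2 \<partial>M) / t < r / 4"
        using N[OF n] t by (simp add: field_simps)
    qed (rule tA)
    finally show "norm (norm (\<integral>x. d n x * f x \<partial>M) - 0) < r" by simp
  qed
qed

text \<open>The limit is taken pointwise along a subsequence with summable \<open>L\<^sup>1\<close>-increments; Fatou's
  lemma turns this into convergence of the whole sequence in \<open>L\<^sup>2\<close>.\<close>

lemma (in finite_measure) L2_complete:
  fixes S :: "nat \<Rightarrow> 'a \<Rightarrow> complex"
  assumes S: "\<And>n. square_integrable M (S n)"
    and cauchy: "\<And>\<epsilon>. \<epsilon> > 0 \<Longrightarrow> \<exists>N. \<forall>m\<ge>N. \<forall>n\<ge>N. (\<integral>x. (cmod (S m x - S n x))\<^sup>2 \<partial>M) \<le> \<epsilon>"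
  shows "\<exists>G. square_integrable M G \<and> (\<lambda>n. \<integral>x. (cmod (S n x - G x))\<^sup>2 \<partial>M) \<longlonglongrightarrow> 0"
proof -
  have Smeas [measurable]: "S n \<in> borel_measurable M" for n
    using S by (simp add: square_integrable_def)
  have Sd: "integrable M (\<lambda>x. (cmod (S m x - S n x))\<^sup>2)" for m n
    using square_integrable_diff[OF S S] by (simp add: square_integrable_def)
  have "\<forall>j. \<exists>N. \<forall>m\<ge>N. \<forall>n\<ge>N. (\<integral>x. (cmod (S m x - S n x))\<^sup>2 \<partial>M) \<le> (1/4)^j"
    by (intro allI cauchy) simp
  then obtain N where N: "\<And>j m n. m \<ge> N j \<Longrightarrow> n \<ge> N j \<Longrightarrow>
      (\<integral>x. (cmod (S m x - S n x))\<^sup>2 \<partial>M) \<le> (1/4)^j"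
    by metis
  \<comment> \<open>The sum makes both \<open>r j\<close> and \<open>r (Suc j)\<close> at least
    \<open>N j\<close>, so the increment \<open>D j\<close> has squared norm at most
    \<open>(1/4)^j\<close>; the summand j makes the indices tend to infinity.\<close>
  define r where "r j = j + (\<Sum>i\<le>j. N i)" for j
  have rN: "r j \<ge> N j" for j
    unfolding r_def by (simp add: sum.remove[of "{..j}" j] trans_le_add2)
  have rN': "r (Suc j) \<ge> N j" for j
    unfolding r_def by (simp add: sum.remove[of "{..j}" j] trans_le_add2)
  have rj: "r j \<ge> j" for j by (simp add: r_def)
  define D where "D j x = S (r (Suc j)) x - S (r j) x" for j x
  have Dmeas [measurable]: "D j \<in> borel_measurable M" for j
    unfolding D_def by simp
  define K where "K = 1 + measure M (space M)"
  have D1: "(\<integral>\<^sup>+x. ennreal (cmod (D j x)) \<partial>M) \<le> ennreal (K * (1/2)^j)" for j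
  proof -
    have int: "integrable M (\<lambda>x. 2^j * (cmod (D j x))\<^sup>2 + (1/2)^j)"
      using Sd unfolding D_def by simp
    have "(\<integral>\<^sup>+x. ennreal (cmod (D j x)) \<partial>M) \<le> (\<integral>\<^sup>+x. ennreal (2^j * (cmod (D j x))\<^sup>2 + (1/2)^j) \<partial>M)"
    proof (intro nn_integral_mono ennreal_leI)
      fix x
      define s where "s = cmod (D j x)"
      have s: "s \<ge> 0" by (simp add: s_def)
      \<comment> \<open>The weight \<open>2^j\<close> balances the two terms: the first integrates
        to at most \<open>2^j * (1/4)^j = (1/2)^j\<close>, the second to \<open>(1/2)^j\<close>
        times the total mass. This is the origin of \<open>K\<close>.\<close>
      have "2 * (2^j * s) \<le> 2^j * (2^j * s\<^sup>2) + 1"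
        using sum_squares_bound[of "2^j * s" 1] by (simp add: power2_eq_square mult_ac)
      hence "(1/2)^j * (2 * (2^j * s)) \<le> (1/2)^j * (2^j * (2^j * s\<^sup>2) + 1)"
        by (intro mult_left_mono) auto
      hence "2 * s \<le> 2^j * s\<^sup>2 + (1/2)^j"
        by (simp add: power_one_over field_simps)
      thus "cmod (D j x) \<le> 2^j * (cmod (D j x))\<^sup>2 + (1/2)^j"
        using s unfolding s_def by linarith
    qed
    also have "\<dots> = ennreal (\<integral>x. 2^j * (cmod (D j x))\<^sup>2 + (1/2)^j \<partial>M)"
      by (intro nn_integral_eq_integral int) simp
    also have "(\<integral>x. 2^j * (cmod (D j x))\<^sup>2 + (1/2)^j \<partial>M)
        = 2^j * (\<integral>x. (cmod (D j x))\<^sup>2 \<partial>M) + (1/2)^j * measure M (space M)"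
      using Sd unfolding D_def by simp
    also have "ennreal \<dots> \<le> ennreal (K * (1/2)^j)"
    proof (rule ennreal_leI)
      have "2^j * (\<integral>x. (cmod (D j x))\<^sup>2 \<partial>M) \<le> 2^j * (1/4)^j"
        unfolding D_def by (intro mult_left_mono N rN rN') auto
      also have "(2::real)^j * (1/4)^j = (1/2)^j"
        by (simp flip: power_mult_distrib)
      finally show "2^j * (\<integral>x. (cmod (D j x))\<^sup>2 \<partial>M) + (1/2)^j * measure M (space M) \<le> K * (1/2)^j"
        by (simp add: K_def algebra_simps)
    qed
    finally show ?thesis .
  qed
  have "(\<integral>\<^sup>+x. (\<Sum>j. ennreal (cmod (D j x))) \<partial>M) = (\<Sum>j. \<integral>\<^sup>+x. ennreal (cmod (D j x)) \<partial>M)"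
    by (intro nn_integral_suminf) simp
  also have "\<dots> \<le> (\<Sum>j. ennreal (K * (1/2)^j))"
    by (intro suminf_le D1) auto
  also have "\<dots> < \<infinity>"
  proof -
    have "summable (\<lambda>j. K * (1/2)^j)" by (intro summable_mult summable_geometric) simp
    moreover have "K \<ge> 0" by (simp add: K_def)
    ultimately show ?thesis
      by (subst suminf_ennreal2) auto
  qed
  finally have "AE x in M. (\<Sum>j. ennreal (cmod (D j x))) \<noteq> \<infinity>"
    by (intro nn_integral_PInf_AE) auto
  hence conv: "AE x in M. convergent (\<lambda>j. S (r j) x)"
  proof eventually_elim
    case (elim x)
    hence "summable (\<lambda>j. cmod (D j x))"
      by (intro summable_suminf_not_top) auto
    hence "summable (\<lambda>j. D j x)" by (rule summable_norm_cancel)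
    hence "convergent (\<lambda>j. \<Sum>i<j. D i x)" by (simp add: summable_iff_convergent)
    hence "convergent (\<lambda>j. S (r 0) x + (\<Sum>i<j. D i x))"
      by (intro convergent_add convergent_const)
    also have "(\<lambda>j. S (r 0) x + (\<Sum>i<j. D i x)) = (\<lambda>j. S (r j) x)"
      unfolding D_def by (subst sum_lessThan_telescope) simp
    finally show ?case .
  qed
  define G where "G x = lim (\<lambda>j. S (r j) x)" for x
  have G [measurable]: "G \<in> borel_measurable M"
    unfolding G_def by measurable
  have lim: "AE x in M. (\<lambda>j. S (r j) x) \<longlonglongrightarrow> G x"
    using conv by eventually_elim (simp add: G_def convergent_LIMSEQ_iff)
  \<comment> \<open>For fixed n the Cauchy bound is passed to the limit along \<open>r j\<close>.
    This controls every late \<open>S n\<close>, not only those of the subsequence.\<close>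
  have fatou: "(\<integral>\<^sup>+x. ennreal ((cmod (S n x - G x))\<^sup>2) \<partial>M) \<le> ennreal \<epsilon>"
    if e: "\<epsilon> > 0" and n: "n \<ge> L" and L: "\<And>m n. m \<ge> L \<Longrightarrow> n \<ge> L \<Longrightarrow>
      (\<integral>x. (cmod (S m x - S n x))\<^sup>2 \<partial>M) \<le> \<epsilon>" for \<epsilon> n L
  proof -
    have "(\<integral>\<^sup>+x. ennreal ((cmod (S n x - G x))\<^sup>2) \<partial>M)
        = (\<integral>\<^sup>+x. liminf (\<lambda>j. ennreal ((cmod (S n x - S (r j) x))\<^sup>2)) \<partial>M)"
    proof (rule nn_integral_cong_AE)
      show "AE x in M. ennreal ((cmod (S n x - G x))\<^sup>2) =
          liminf (\<lambda>j. ennreal ((cmod (S n x - S (r j) x))\<^sup>2))"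
        using lim
      proof eventually_elim
        case (elim x)
        have "(\<lambda>j. ennreal ((cmod (S n x - S (r j) x))\<^sup>2)) \<longlonglongrightarrow> ennreal ((cmod (S n x - G x))\<^sup>2)"
          by (intro tendsto_intros elim)
        thus ?case by (intro lim_imp_Liminf[symmetric]) simp_all
      qed
    qed
    also have "\<dots> \<le> liminf (\<lambda>j. \<integral>\<^sup>+x. ennreal ((cmod (S n x - S (r j) x))\<^sup>2) \<partial>M)"
      by (intro nn_integral_liminf) simp
    also have "\<dots> \<le> liminf (\<lambda>j. ennreal \<epsilon>)"
    proof (rule Liminf_mono, rule eventually_sequentiallyI[of L])
      fix j assume "j \<ge> L"
      hence "r j \<ge> L" using rj[of j] by linarith
      have "(\<integral>\<^sup>+x. ennreal ((cmod (S n x - S (r j) x))\<^sup>2) \<partial>M)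
          = ennreal (\<integral>x. (cmod (S n x - S (r j) x))\<^sup>2 \<partial>M)"
        by (intro nn_integral_eq_integral Sd) simp
      also have "\<dots> \<le> ennreal \<epsilon>"
        by (intro ennreal_leI L n \<open>r j \<ge> L\<close>)
      finally show "(\<integral>\<^sup>+x. ennreal ((cmod (S n x - S (r j) x))\<^sup>2) \<partial>M) \<le> ennreal \<epsilon>" .
    qed
    also have "\<dots> = ennreal \<epsilon>" by (simp add: Liminf_const)
    finally show ?thesis .
  qed
  have Gsq: "square_integrable M G"
  proof -
    from cauchy[of 1] obtain L where L: "\<And>m n. m \<ge> L \<Longrightarrow> n \<ge> L \<Longrightarrow>
      (\<integral>x. (cmod (S m x - S n x))\<^sup>2 \<partial>M) \<le> 1" by auto
    have "(\<integral>\<^sup>+x. ennreal ((cmod (S L x - G x))\<^sup>2) \<partial>M) \<le> ennreal 1"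
      by (rule fatou[OF _ order_refl L]) simp_all
    also have "\<dots> < \<infinity>" by simp
    finally have "integrable M (\<lambda>x. (cmod (S L x - G x))\<^sup>2)"
      by (intro integrableI_nonneg) auto
    hence "square_integrable M (\<lambda>x. S L x - G x)"
      by (simp add: square_integrable_def)
    from square_integrable_diff[OF S[of L] this] show ?thesis by simp
  qed
  moreover have "(\<lambda>n. \<integral>x. (cmod (S n x - G x))\<^sup>2 \<partial>M) \<longlonglongrightarrow> 0"
  proof (rule LIMSEQ_I)
    fix e :: real assume e: "0 < e"
    from cauchy[of "e/2"] e obtain L where L: "\<And>m n. m \<ge> L \<Longrightarrow> n \<ge> L \<Longrightarrow>
      (\<integral>x. (cmod (S m x - S n x))\<^sup>2 \<partial>M) \<le> e/2" by auto
    show "\<exists>L. \<forall>n\<ge>L. norm ((\<integral>x. (cmod (S n x - G x))\<^sup>2 \<partial>M) - 0) < e"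
    proof (intro exI[of _ L] allI impI)
      fix n assume n: "L \<le> n"
      have "ennreal (\<integral>x. (cmod (S n x - G x))\<^sup>2 \<partial>M) = (\<integral>\<^sup>+x. ennreal ((cmod (S n x - G x))\<^sup>2) \<partial>M)"
        using square_integrable_diff[OF S Gsq]
        by (intro nn_integral_eq_integral[symmetric]) (auto simp: square_integrable_def)
      also have "\<dots> \<le> ennreal (e/2)"
        by (rule fatou[OF _ n L]) (use e in simp_all)
      finally show "norm ((\<integral>x. (cmod (S n x - G x))\<^sup>2 \<partial>M) - 0) < e"
        using e by (simp add: ennreal_le_iff)
    qed
  qed
  ultimately show ?thesis by blast
qed

section \<open>Bounded real orthogonal systems\<close>

text \<open>Real functions keep conjugates out of the coefficients. The common squared norm c is pi
  for both systems below, so the factor 1 / c in \<open>coeff\<close> agrees with the normalisation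
  of \<open>fourier\<close>.\<close>

locale orthogonal_system = finite_measure M for M :: "'a measure" +
  fixes e :: "nat \<Rightarrow> 'a \<Rightarrow> real" and c B :: real
  assumes c_pos: "c > 0"
    and e_meas [measurable]: "\<And>k. e k \<in> borel_measurable M"
    and e_bound: "\<And>k x. x \<in> space M \<Longrightarrow> \<bar>e k x\<bar> \<le> B"
    and orthogonal: "\<And>i j. (\<integral>x. e i x * e j x \<partial>M) = (if i = j then c else 0)"
begin

definition coeff :: "('a \<Rightarrow> complex) \<Rightarrow> nat \<Rightarrow> complex" where
  "coeff f k = complex_of_real (1 / c) * (\<integral>x. f x * complex_of_real (e k x) \<partial>M)"

definition part :: "(nat \<Rightarrow> complex) \<Rightarrow> nat \<Rightarrow> 'a \<Rightarrow> complex" where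
  "part a n x = (\<Sum>k<n. a k * complex_of_real (e k x))"

lemma square_integrable_e: "square_integrable M (\<lambda>x. complex_of_real (e k x))"
  by (rule square_integrable_bounded[where B = B]) (auto simp: e_bound)

lemma square_integrable_part: "square_integrable M (part a n)"
  unfolding part_def by (intro square_integrable_sum square_integrable_cmult square_integrable_e)

lemma integral_part_mult:
  assumes "square_integrable M f"
  shows "(\<integral>x. part a n x * f x \<partial>M) = (\<Sum>k<n. a k * (\<integral>x. complex_of_real (e k x) * f x \<partial>M))"
proof -
  have "(\<integral>x. part a n x * f x \<partial>M) = (\<integral>x. (\<Sum>k<n. a k * (complex_of_real (e k x) * f x)) \<partial>M)"
    unfolding part_def sum_distrib_right by (simp only: mult.assoc)
  also have "\<dots> = (\<Sum>k<n. \<integral>x. a k * (complex_of_real (e k x) * f x) \<partial>M)"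
    by (intro Bochner_Integration.integral_sum integrable_mult_right square_integrable_mult square_integrable_e assms)
  finally show ?thesis by simp
qed

lemma orthogonal_complex:
  "(\<integral>x. complex_of_real (e i x) * complex_of_real (e j x) \<partial>M) = (if i = j then complex_of_real c else 0)"
proof -
  have "(\<integral>x. complex_of_real (e i x) * complex_of_real (e j x) \<partial>M)
      = (\<integral>x. complex_of_real (e i x * e j x) \<partial>M)" by simp
  also have "\<dots> = complex_of_real (\<integral>x. e i x * e j x \<partial>M)" by (rule integral_complex_of_real)
  finally show ?thesis by (simp add: orthogonal)
qed

lemma integral_part_e:
  "(\<integral>x. part a n x * complex_of_real (e k x) \<partial>M) = (if k < n then complex_of_real c * a k else 0)"
proof -
  have "(\<integral>x. part a n x * complex_of_real (e k x) \<partial>M)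
      = (\<Sum>i<n. a i * (if i = k then complex_of_real c else 0))"
    by (simp add: integral_part_mult[OF square_integrable_e] orthogonal_complex)
  also have "\<dots> = (\<Sum>i<n. if i = k then complex_of_real c * a i else 0)"
    by (intro sum.cong) auto
  also have "\<dots> = (if k < n then complex_of_real c * a k else 0)"
    by (simp add: sum.delta)
  finally show ?thesis .
qed

lemma cnj_part: "cnj (part a n x) = part (\<lambda>k. cnj (a k)) n x"
  by (simp add: part_def)

lemma norm_part:
  "(\<integral>x. (cmod (part a n x))\<^sup>2 \<partial>M) = c * (\<Sum>k<n. (cmod (a k))\<^sup>2)"
proof -
  have "complex_of_real (\<integral>x. (cmod (part a n x))\<^sup>2 \<partial>M)
      = (\<integral>x. complex_of_real ((cmod (part a n x))\<^sup>2) \<partial>M)"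
    by (rule integral_complex_of_real[symmetric])
  also have "\<dots> = (\<integral>x. part a n x * part (\<lambda>k. cnj (a k)) n x \<partial>M)"
    by (simp add: complex_norm_square cnj_part del: of_real_power)
  also have "\<dots> = (\<Sum>k<n. a k * (\<integral>x. part (\<lambda>k. cnj (a k)) n x * complex_of_real (e k x) \<partial>M))"
    by (simp add: integral_part_mult[OF square_integrable_part] mult.commute)
  also have "\<dots> = (\<Sum>k<n. complex_of_real (c * (cmod (a k))\<^sup>2))"
    by (simp only: integral_part_e) (simp add: complex_norm_square mult_ac del: of_real_power)
  also have "\<dots> = complex_of_real (c * (\<Sum>k<n. (cmod (a k))\<^sup>2))"
    by (simp add: sum_distrib_left)
  finally show ?thesis by (simp only: of_real_eq_iff)
qed

section \<open>Riesz-Fischer, Bessel and Parseval\<close>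

lemma riesz_fischer:
  assumes a: "summable (\<lambda>k. (cmod (a k))\<^sup>2)"
  obtains G where "square_integrable M G"
    "(\<lambda>n. \<integral>x. (cmod (part a n x - G x))\<^sup>2 \<partial>M) \<longlonglongrightarrow> 0"
proof -
  have diff: "(\<integral>x. (cmod (part a m x - part a n x))\<^sup>2 \<partial>M) = c * (\<Sum>k\<in>{n..<m}. (cmod (a k))\<^sup>2)"
    if "n \<le> m" for m n
  proof -
    \<comment> \<open>A difference of partial sums is itself a partial sum, with the first n
      coefficients cut off, so \<open>norm_part\<close> computes its norm.\<close>
    define b where "b k = (if k < n then 0 else a k)" for k
    have split: "{..<m} = {..<n} \<union> {n..<m}" using that by auto
    have "part a m x - part a n x = part b m x" for x
      unfolding part_def split by (subst (1 2) sum.union_disjoint) (auto simp: b_def)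
    hence "(\<integral>x. (cmod (part a m x - part a n x))\<^sup>2 \<partial>M) = c * (\<Sum>k<m. (cmod (b k))\<^sup>2)"
      by (simp add: norm_part)
    also have "(\<Sum>k<m. (cmod (b k))\<^sup>2) = (\<Sum>k\<in>{n..<m}. (cmod (a k))\<^sup>2)"
      unfolding split by (subst sum.union_disjoint) (auto simp: b_def)
    finally show ?thesis .
  qed
  have "\<exists>G. square_integrable M G \<and> (\<lambda>n. \<integral>x. (cmod (part a n x - G x))\<^sup>2 \<partial>M) \<longlonglongrightarrow> 0"
  proof (rule L2_complete[OF square_integrable_part])
    fix \<epsilon> :: real assume e: "\<epsilon> > 0"
    hence "\<epsilon> / c > 0" using c_pos by simp
    then obtain N where N: "\<And>m n. m \<ge> N \<Longrightarrow> norm (\<Sum>k\<in>{m..<n}. (cmod (a k))\<^sup>2) < \<epsilon> / c"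
      using a unfolding summable_Cauchy by blast
    have *: "(\<integral>x. (cmod (part a m x - part a n x))\<^sup>2 \<partial>M) \<le> \<epsilon>" if "N \<le> n" "n \<le> m" for m n
    proof -
      have "(\<Sum>k\<in>{n..<m}. (cmod (a k))\<^sup>2) \<le> \<epsilon> / c" using N[OF that(1), of m] by simp
      thus ?thesis using diff[OF that(2)] c_pos by (simp add: field_simps)
    qed
    show "\<exists>N. \<forall>m\<ge>N. \<forall>n\<ge>N. (\<integral>x. (cmod (part a m x - part a n x))\<^sup>2 \<partial>M) \<le> \<epsilon>"
    proof (intro exI[of _ N] allI impI)
      fix m n assume mn: "N \<le> m" "N \<le> n"
      show "(\<integral>x. (cmod (part a m x - part a n x))\<^sup>2 \<partial>M) \<le> \<epsilon>"
        using *[of n m] *[of m n] mn by (cases "n \<le> m") (auto simp: norm_minus_commute)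
    qed
  qed
  with that show thesis by blast
qed

text \<open>Convergence in the mean implies weak convergence, so a pairing with a fixed square
  integrable function may be computed term by term.\<close>

lemma sums_integral_part:
  assumes G: "square_integrable M G"
    and lim: "(\<lambda>n. \<integral>x. (cmod (part a n x - G x))\<^sup>2 \<partial>M) \<longlonglongrightarrow> 0"
    and f: "square_integrable M f"
  shows "(\<lambda>k. a k * (\<integral>x. complex_of_real (e k x) * f x \<partial>M)) sums (\<integral>x. G x * f x \<partial>M)"
proof -
  have "(\<lambda>n. \<integral>x. (part a n x - G x) * f x \<partial>M) \<longlonglongrightarrow> 0"
    by (intro tendsto_integral_mult_L2 square_integrable_diff square_integrable_part G f lim)
  also have "(\<lambda>n. \<integral>x. (part a n x - G x) * f x \<partial>M)
      = (\<lambda>n. (\<Sum>k<n. a k * (\<integral>x. complex_of_real (e k x) * f x \<partial>M)) - (\<integral>x. G x * f x \<partial>M))"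
    using square_integrable_mult[OF square_integrable_part f] square_integrable_mult[OF G f]
    by (simp add: left_diff_distrib integral_part_mult[OF f])
  finally show ?thesis unfolding sums_def by (simp add: LIM_zero_iff)
qed

lemma coeff_limit:
  assumes "square_integrable M G"
    and "(\<lambda>n. \<integral>x. (cmod (part a n x - G x))\<^sup>2 \<partial>M) \<longlonglongrightarrow> 0"
  shows "coeff G = a"
proof
  fix k
  have "(\<lambda>i. if i = k then a k * complex_of_real c else 0) sums (\<integral>x. G x * complex_of_real (e k x) \<partial>M)"
  proof -
    have "(\<lambda>i. a i * (if i = k then complex_of_real c else 0)) =
      (\<lambda>i. if i = k then a k * complex_of_real c else 0)" by auto
    with sums_integral_part[OF assms square_integrable_e[of k]] show ?thesis
      by (simp add: orthogonal_complex)
  qed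
  hence "(\<integral>x. G x * complex_of_real (e k x) \<partial>M) = a k * complex_of_real c"
    using sums_If_finite_set[of "{k}" "\<lambda>i. a k * complex_of_real c"] sums_unique2 by fastforce
  thus "coeff G k = a k" using c_pos by (simp add: coeff_def)
qed

text \<open>In the expansion of the squared norm of \<open>f - part a n\<close> the cross term is -2
  times, and the norm of the partial sum once, the same quantity c times the sum of |a_k|^2.
  Nonnegativity then bounds this sum independently of n.\<close>

lemma bessel:
  assumes f: "square_integrable M f"
  shows "summable (\<lambda>k. (cmod (coeff f k))\<^sup>2)"
proof (rule summableI_nonneg_bounded)
  fix n
  define a where "a = coeff f"
  have int: "(\<integral>x. f x * complex_of_real (e k x) \<partial>M) = complex_of_real c * a k" for k
    using c_pos by (simp add: coeff_def a_def)
  have sq: "integrable M (\<lambda>x. (cmod (f x))\<^sup>2)" "integrable M (\<lambda>x. (cmod (part a n x))\<^sup>2)"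
    using f square_integrable_part by (auto simp: square_integrable_def)
  have intc: "integrable M (\<lambda>x. part (\<lambda>k. cnj (a k)) n x * f x)"
    by (intro square_integrable_mult square_integrable_part f)
  have "(\<integral>x. part (\<lambda>k. cnj (a k)) n x * f x \<partial>M)
      = (\<Sum>k<n. cnj (a k) * (complex_of_real c * a k))"
    by (subst integral_part_mult[OF f]) (simp add: int[symmetric] mult.commute)
  also have "\<dots> = (\<Sum>k<n. complex_of_real (c * (cmod (a k))\<^sup>2))"
    by (simp add: complex_norm_square mult_ac del: of_real_power)
  also have "\<dots> = complex_of_real (c * (\<Sum>k<n. (cmod (a k))\<^sup>2))"
    by (simp add: sum_distrib_left)
  finally have cross: "(\<integral>x. Re (part (\<lambda>k. cnj (a k)) n x * f x) \<partial>M) = c * (\<Sum>k<n. (cmod (a k))\<^sup>2)"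
    by (subst integral_Re[OF intc]) simp
  have expand: "(cmod (f x - part a n x))\<^sup>2
      = (cmod (f x))\<^sup>2 + (cmod (part a n x))\<^sup>2 - 2 * Re (part (\<lambda>k. cnj (a k)) n x * f x)" for x
    unfolding cnj_part[symmetric] cmod_power2 by (simp add: power2_eq_square algebra_simps)
  have "0 \<le> (\<integral>x. (cmod (f x - part a n x))\<^sup>2 \<partial>M)" by simp
  also have "\<dots> = (\<integral>x. (cmod (f x))\<^sup>2 \<partial>M) + (\<integral>x. (cmod (part a n x))\<^sup>2 \<partial>M)
      - 2 * (\<integral>x. Re (part (\<lambda>k. cnj (a k)) n x * f x) \<partial>M)"
    unfolding expand using sq integrable_Re[OF intc] by (simp del: times_complex.simps)
  also have "\<dots> = (\<integral>x. (cmod (f x))\<^sup>2 \<partial>M) - c * (\<Sum>k<n. (cmod (a k))\<^sup>2)"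
    by (simp only: norm_part cross)
  finally show "(\<Sum>k<n. (cmod (coeff f k))\<^sup>2) \<le> (\<integral>x. (cmod (f x))\<^sup>2 \<partial>M) / c"
    using c_pos by (simp add: field_simps a_def)
qed simp

text \<open>Parseval's identity, paired with a second function; completeness of the system enters only
  as uniqueness for the single function \<open>f\<close>.\<close>

lemma parseval:
  assumes f: "square_integrable M f" and p: "square_integrable M p"
    and unique: "\<And>G. square_integrable M G \<Longrightarrow> coeff G = coeff f \<Longrightarrow> AE x in M. G x = f x"
  shows "(\<lambda>k. coeff f k * (\<integral>x. complex_of_real (e k x) * p x \<partial>M)) sums (\<integral>x. f x * p x \<partial>M)"
proof -
  obtain G where G: "square_integrable M G"
    "(\<lambda>n. \<integral>x. (cmod (part (coeff f) n x - G x))\<^sup>2 \<partial>M) \<longlonglongrightarrow> 0"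
    using riesz_fischer[OF bessel[OF f]] by blast
  have "AE x in M. G x = f x" using G by (intro unique coeff_limit)
  hence "(\<integral>x. G x * p x \<partial>M) = (\<integral>x. f x * p x \<partial>M)"
    using G f p by (intro integral_cong_AE) (auto simp: square_integrable_def)
  with sums_integral_part[OF G p] show ?thesis by simp
qed

end

section \<open>The interval from 0 to \<open>\<pi>\<close> and the trigonometric systems\<close>

text \<open>As a finite measure space of its own, the interval falls under the general results
  above; the set integrals of the statement are translated into it.\<close>

definition Lpi :: "real measure" where "Lpi = restrict_space lborel {0..pi}"

lemma space_Lpi: "space Lpi = {0..pi}"
  by (simp add: Lpi_def space_restrict_space)

lemma Lpi_ident [measurable]: "(\<lambda>x. x) \<in> borel_measurable Lpi"
  unfolding Lpi_def by (rule measurable_restrict_space1) simp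

lemma borel_measurable_Lpi_continuous:
  fixes f :: "real \<Rightarrow> 'a::topological_space"
  assumes "continuous_on UNIV f"
  shows "f \<in> borel_measurable Lpi"
  using measurable_compose[OF Lpi_ident borel_measurable_continuous_onI[OF assms]] by simp

lemma finite_measure_Lpi: "finite_measure Lpi"
  by (rule finite_measureI) (simp add: Lpi_def space_restrict_space emeasure_restrict_space)

interpretation Lpi: finite_measure Lpi by (rule finite_measure_Lpi)

interpretation Lpi_pair: pair_sigma_finite Lpi Lpi by unfold_locales

lemma measure_Lpi: "measure Lpi (space Lpi) = pi"
  by (simp add: Lpi_def space_restrict_space measure_restrict_space)

lemma set_borel_measurable_Lpi:
  fixes f :: "real \<Rightarrow> complex"
  shows "set_borel_measurable lborel {0..pi} f \<longleftrightarrow> f \<in> borel_measurable Lpi"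
  by (simp add: set_borel_measurable_def Lpi_def borel_measurable_restrict_space_iff)

lemma set_integrable_Lpi:
  fixes f :: "real \<Rightarrow> 'a::{banach, second_countable_topology}"
  shows "set_integrable lborel {0..pi} f \<longleftrightarrow> integrable Lpi f"
  by (simp add: set_integrable_def Lpi_def integrable_restrict_space)

lemma set_integral_Lpi:
  fixes f :: "real \<Rightarrow> 'a::{banach, second_countable_topology}"
  shows "(LINT x:{0..pi}|lborel. f x) = (\<integral>x. f x \<partial>Lpi)"
  by (simp add: set_lebesgue_integral_def Lpi_def integral_restrict_space)

lemma AE_Lpi: "(AE x in lborel. x \<in> {0..pi} \<longrightarrow> P x) \<longleftrightarrow> (AE x in Lpi. P x)"
  unfolding Lpi_def by (subst AE_restrict_space_iff) auto

lemma AE_Lpi_neq: "AE x in Lpi. x \<noteq> a"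
  unfolding AE_Lpi[symmetric] using AE_lborel_singleton[of a] by eventually_elim simp

lemma L2_on_iff: "L2_on f \<longleftrightarrow> square_integrable Lpi f"
  by (simp add: L2_on_def square_integrable_def set_borel_measurable_Lpi set_integrable_Lpi)

section \<open>Primitives of integrable functions and integration by parts\<close>

definition primitive :: "(real \<Rightarrow> complex) \<Rightarrow> real \<Rightarrow> complex" where
  "primitive w x = (\<integral>t. (if t \<le> x then w t else 0) \<partial>Lpi)"

lemma set_integral_primitive:
  assumes "x \<in> {0..pi}"
  shows "(LINT t:{0..x}|lborel. w t) = primitive w x"
  unfolding set_lebesgue_integral_def primitive_def set_integral_Lpi[symmetric]
  using assms by (intro Bochner_Integration.integral_cong) (auto simp: indicator_def)

lemma integral_FTC_Lpi:
  fixes F f :: "real \<Rightarrow> real"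
  assumes "t \<in> {0..pi}" and F: "\<And>x. (F has_real_derivative f x) (at x)" and f: "continuous_on UNIV f"
  shows "(\<integral>x. (if t \<le> x then f x else 0) \<partial>Lpi) = F pi - F t"
proof -
  have "(\<integral>x. (if t \<le> x then f x else 0) \<partial>Lpi) = (\<integral>x. indicator {t..pi} x *\<^sub>R f x \<partial>lborel)"
    unfolding set_integral_Lpi[symmetric] set_lebesgue_integral_def
    using assms(1) by (intro Bochner_Integration.integral_cong) (auto simp: indicator_def)
  also have "\<dots> = F pi - F t"
    using assms(1) by (intro integral_FTC_atLeastAtMost continuous_on_subset[OF f])
      (auto intro: has_vector_derivative_at_within F[unfolded has_real_derivative_iff_has_vector_derivative])
  finally show ?thesis .
qed

lemma integrable_bounded_mult:
  fixes b h :: "'a \<Rightarrow> complex"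
  assumes "integrable M h" "b \<in> borel_measurable M" "\<And>x. x \<in> space M \<Longrightarrow> cmod (b x) \<le> B"
  shows "integrable M (\<lambda>x. b x * h x)"
proof (rule Bochner_Integration.integrable_bound)
  show "integrable M (\<lambda>x. complex_of_real B * h x)" using assms by simp
  show "(\<lambda>x. b x * h x) \<in> borel_measurable M" using assms by auto
  show "AE x in M. norm (b x * h x) \<le> norm (complex_of_real B * h x)"
  proof (rule AE_I2)
    fix x assume "x \<in> space M"
    with assms(3) have "cmod (b x) \<le> \<bar>B\<bar>" by force
    thus "norm (b x * h x) \<le> norm (complex_of_real B * h x)"
      by (auto simp: norm_mult intro: mult_right_mono)
  qed
qed

lemma continuous_bounded_Icc:
  fixes b :: "real \<Rightarrow> real"
  assumes "continuous_on UNIV b"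
  obtains B where "\<And>x. x \<in> {0..pi} \<Longrightarrow> \<bar>b x\<bar> \<le> B"
proof -
  have "bounded (b ` {0..pi})"
    by (auto intro!: compact_imp_bounded compact_continuous_image continuous_on_subset[OF assms])
  hence "\<exists>B. \<forall>x\<in>{0..pi}. \<bar>b x\<bar> \<le> B"
    unfolding bounded_iff by simp
  with that show thesis by blast
qed

lemma primitive_measurable [measurable]:
  assumes [measurable]: "w \<in> borel_measurable Lpi"
  shows "primitive w \<in> borel_measurable Lpi"
  unfolding primitive_def[abs_def] by measurable

lemma integrable_truncated:
  fixes w :: "real \<Rightarrow> complex"
  assumes "integrable Lpi w"
  shows "integrable Lpi (\<lambda>t. if t \<le> x then w t else 0)"
proof (rule Bochner_Integration.integrable_bound[OF assms])
  have [measurable]: "w \<in> borel_measurable Lpi" using assms by simp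
  show "(\<lambda>t. if t \<le> x then w t else 0) \<in> borel_measurable Lpi" by measurable
qed auto

lemma primitive_bounded:
  assumes "integrable Lpi w"
  shows "cmod (primitive w x) \<le> (\<integral>t. cmod (w t) \<partial>Lpi)"
proof -
  have "cmod (primitive w x) \<le> (\<integral>t. cmod (if t \<le> x then w t else 0) \<partial>Lpi)"
    unfolding primitive_def by (rule integral_norm_bound)
  also have "\<dots> \<le> (\<integral>t. cmod (w t) \<partial>Lpi)"
    using assms by (intro integral_mono integrable_norm integrable_truncated) auto
  finally show ?thesis .
qed

lemma primitive_0: "primitive w 0 = 0"
  unfolding primitive_def
proof (rule integral_eq_zero_AE)
  show "AE t in Lpi. (if t \<le> 0 then w t else 0) = 0"
    using AE_Lpi_neq[of 0] AE_space[of Lpi] by eventually_elim (auto simp: space_Lpi)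
qed

lemma primitive_pi: "primitive w pi = (\<integral>t. w t \<partial>Lpi)"
  unfolding primitive_def by (intro Bochner_Integration.integral_cong) (auto simp: space_Lpi)

text \<open>The primitive of an integrable function need not be differentiable everywhere, so the
  product rule is replaced by Fubini on the triangle t \<le> x. Integrating f over [t, pi] first
  gives F(pi) - F(t).\<close>

lemma integration_by_parts_primitive:
  fixes w :: "real \<Rightarrow> complex" and F f :: "real \<Rightarrow> real"
  assumes w: "integrable Lpi w"
    and F: "\<And>x. (F has_real_derivative f x) (at x)" and f: "continuous_on UNIV f"
  shows "(\<integral>x. primitive w x * complex_of_real (f x) \<partial>Lpi)
    = primitive w pi * complex_of_real (F pi) - (\<integral>x. w x * complex_of_real (F x) \<partial>Lpi)"
proof -
  have wm [measurable]: "w \<in> borel_measurable Lpi" using w by simp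
  have fm [measurable]: "f \<in> borel_measurable Lpi" by (rule borel_measurable_Lpi_continuous[OF f])
  have Fc: "continuous_on UNIV F"
    using F by (meson DERIV_isCont continuous_at_imp_continuous_on)
  have Fm [measurable]: "F \<in> borel_measurable Lpi"
    by (rule borel_measurable_Lpi_continuous[OF Fc])
  obtain B where B: "\<And>x. x \<in> {0..pi} \<Longrightarrow> \<bar>f x\<bar> \<le> B"
    using continuous_bounded_Icc[OF f] by blast
  obtain B' where B': "\<And>x. x \<in> {0..pi} \<Longrightarrow> \<bar>F x\<bar> \<le> B'"
    using continuous_bounded_Icc[OF Fc] by blast
  \<comment> \<open>The truncation sits in the integrand and not in the domain, so that both
    iterated integrals run over the same measure \<open>Lpi\<close>.\<close>
  define k where "k t x = w t * complex_of_real (if t \<le> x then f x else 0)" for t x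
  have km [measurable]: "case_prod k \<in> borel_measurable (Lpi \<Otimes>\<^sub>M Lpi)"
    unfolding k_def[abs_def] by measurable
  have fi: "integrable Lpi (\<lambda>x. if t \<le> x then f x else 0)" for t
    by (rule Lpi.integrable_const_bound[where B = B]) (use B in \<open>force simp: space_Lpi\<close>, measurable)
  have ki: "integrable Lpi (\<lambda>x. k t x)" for t
    unfolding k_def using fi by (intro integrable_mult_right integrable_of_real)
  have "integrable (Lpi \<Otimes>\<^sub>M Lpi) (case_prod k)"
  proof (rule Lpi_pair.Fubini_integrable[OF km])
    show "integrable Lpi (\<lambda>t. \<integral>x. norm (case_prod k (t, x)) \<partial>Lpi)"
    proof (rule Bochner_Integration.integrable_bound)
      show "integrable Lpi (\<lambda>t. (B * pi) * cmod (w t))" using w by simp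
      show "(\<lambda>t. \<integral>x. norm (case_prod k (t, x)) \<partial>Lpi) \<in> borel_measurable Lpi" by measurable
      show "AE t in Lpi. norm (\<integral>x. norm (case_prod k (t, x)) \<partial>Lpi) \<le> norm ((B * pi) * cmod (w t))"
      proof (rule AE_I2)
        fix t
        have "B \<ge> 0" using B[of 0] by simp
        have "(\<integral>x. norm (case_prod k (t, x)) \<partial>Lpi) \<le> (\<integral>x. B * cmod (w t) \<partial>Lpi)"
        proof (rule integral_mono)
          show "integrable Lpi (\<lambda>x. norm (case_prod k (t, x)))"
            using integrable_norm[OF ki] by simp
          show "integrable Lpi (\<lambda>x. B * cmod (w t))" by simp
          fix x assume "x \<in> space Lpi"
          hence "\<bar>if t \<le> x then f x else 0\<bar> \<le> B" using B \<open>B \<ge> 0\<close> by (auto simp: space_Lpi)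
          hence "cmod (w t) * \<bar>if t \<le> x then f x else 0\<bar> \<le> cmod (w t) * B"
            by (intro mult_left_mono) auto
          thus "norm (case_prod k (t, x)) \<le> B * cmod (w t)"
            by (simp only: k_def case_prod_conv norm_mult norm_of_real mult.commute)
        qed
        thus "norm (\<integral>x. norm (case_prod k (t, x)) \<partial>Lpi) \<le> norm ((B * pi) * cmod (w t))"
          using \<open>B \<ge> 0\<close> by (simp add: measure_Lpi mult_ac)
      qed
    qed
    show "AE t in Lpi. integrable Lpi (\<lambda>x. case_prod k (t, x))" using ki by simp
  qed
  hence "(\<integral>x. (\<integral>t. k t x \<partial>Lpi) \<partial>Lpi) = (\<integral>t. (\<integral>x. k t x \<partial>Lpi) \<partial>Lpi)"
    by (rule Lpi_pair.Fubini_integral)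
  also have "(\<lambda>x. \<integral>t. k t x \<partial>Lpi) = (\<lambda>x. primitive w x * complex_of_real (f x))"
  proof
    fix x
    have "(\<integral>t. k t x \<partial>Lpi) = (\<integral>t. (if t \<le> x then w t else 0) * complex_of_real (f x) \<partial>Lpi)"
      unfolding k_def by (intro Bochner_Integration.integral_cong) auto
    thus "(\<integral>t. k t x \<partial>Lpi) = primitive w x * complex_of_real (f x)"
      by (simp add: primitive_def)
  qed
  also have "(\<integral>t. (\<integral>x. k t x \<partial>Lpi) \<partial>Lpi) = (\<integral>t. w t * complex_of_real (F pi) - w t * complex_of_real (F t) \<partial>Lpi)"
  proof (rule Bochner_Integration.integral_cong[OF refl])
    fix t assume "t \<in> space Lpi"
    hence FTC: "(\<integral>x. (if t \<le> x then f x else 0) \<partial>Lpi) = F pi - F t"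
      by (intro integral_FTC_Lpi F f) (auto simp: space_Lpi)
    thus "(\<integral>x. k t x \<partial>Lpi) = w t * complex_of_real (F pi) - w t * complex_of_real (F t)"
      unfolding k_def integral_mult_right_zero integral_complex_of_real FTC by (simp add: algebra_simps)
  qed
  also have "\<dots> = primitive w pi * complex_of_real (F pi) - (\<integral>x. w x * complex_of_real (F x) \<partial>Lpi)"
  proof -
    have "integrable Lpi (\<lambda>t. complex_of_real (F t) * w t)"
      by (rule integrable_bounded_mult[OF w, where B = B']) (use B' in \<open>auto simp: space_Lpi\<close>)
    thus ?thesis using w by (simp add: primitive_pi mult.commute)
  qed
  finally show ?thesis .
qed

section \<open>Completeness of the cosines and of the sines\<close>

lemma AE_zero_if_initial_integrals_zero:
  assumes h: "integrable Lpi h" and zero: "\<And>a. primitive h a = 0"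
  shows "AE x in Lpi. h x = (0 :: complex)"
proof -
  have si: "set_integrable Lpi A h" if "A \<in> sets borel" for A
  proof -
    have [measurable]: "A \<in> sets borel" by fact
    have "{x \<in> space Lpi. x \<in> A} \<in> sets Lpi" by measurable
    hence "integrable Lpi (\<lambda>x. indicator {x \<in> space Lpi. x \<in> A} x *\<^sub>R h x)"
      using h by (rule integrable_mult_indicator)
    also have "?this \<longleftrightarrow> ?thesis" unfolding set_integrable_def
      by (intro Bochner_Integration.integrable_cong) (auto simp: indicator_def)
    finally show ?thesis .
  qed
  have borel: "set_lebesgue_integral Lpi A h = 0" if "A \<in> sets borel" for A
  proof -
    \<comment> \<open>Half-lines form an intersection-stable generator of the Borel sets, and on
      them the hypothesis gives zero integrals. The sets with zero integral are closed under
      complements and countable disjoint unions.\<close>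
    have "Int_stable (range (atMost :: real \<Rightarrow> real set))"
      by (auto simp: Int_stable_def)
    moreover have "range (atMost :: real \<Rightarrow> real set) \<subseteq> Pow UNIV" by simp
    moreover have "A \<in> sigma_sets UNIV (range (atMost :: real \<Rightarrow> real set))"
      using that by (simp add: borel_eq_atMost)
    ultimately show ?thesis
    proof (induction rule: sigma_sets_induct_disjoint)
      case (basic A)
      then obtain a where A: "A = {..a}" by auto
      have "set_lebesgue_integral Lpi A h = primitive h a"
        unfolding set_lebesgue_integral_def primitive_def A
        by (intro Bochner_Integration.integral_cong) (auto simp: indicator_def)
      with zero show ?case by simp
    next
      case empty
      show ?case by (simp add: set_lebesgue_integral_def)
    next
      case (compl A)
      hence Ab: "A \<in> sets borel" by (simp add: borel_eq_atMost)
      \<comment> \<open>The complement needs the total integral of h to vanish, which is the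
        hypothesis at \<open>a = pi\<close>.\<close>
      have "set_lebesgue_integral Lpi (UNIV - A) h = (\<integral>x. h x - indicator A x *\<^sub>R h x \<partial>Lpi)"
        unfolding set_lebesgue_integral_def
        by (intro Bochner_Integration.integral_cong) (auto simp: indicator_def)
      also have "\<dots> = 0"
        using compl.IH si[OF Ab] h zero[of pi]
        by (subst Bochner_Integration.integral_diff) (auto simp: set_lebesgue_integral_def set_integrable_def primitive_pi)
      finally show ?case .
    next
      case (union A)
      hence Ab: "A i \<in> sets borel" for i by (auto simp: borel_eq_atMost)
      \<comment> \<open>Countable additivity requires measurable subsets of the interval;
        intersecting with it does not change any of the integrals.\<close>
      define A' where "A' i = A i \<inter> space Lpi" for i
      have A': "A' i \<in> sets Lpi" for i
        using Ab[of i] by (auto simp: A'_def Lpi_def sets_restrict_space space_restrict_space)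
      have eq: "set_lebesgue_integral Lpi (X \<inter> space Lpi) h = set_lebesgue_integral Lpi X h" for X
        unfolding set_lebesgue_integral_def
        by (intro Bochner_Integration.integral_cong) (auto simp: indicator_def)
      have "set_lebesgue_integral Lpi (\<Union>i. A' i) h = (\<Sum>i. set_lebesgue_integral Lpi (A' i) h)"
      proof (rule lebesgue_integral_countable_add)
        show "set_integrable Lpi (\<Union>i. A' i) h"
          unfolding set_integrable_def
          using A' h by (intro integrable_mult_indicator) auto
      qed (use A' union in \<open>auto simp: A'_def disjoint_family_on_def\<close>)
      also have "\<dots> = 0" by (simp add: A'_def eq union)
      finally show ?case
        using eq[of "\<Union>i. A i"] by (simp add: A'_def)
    qed
  qed
  have "AE x in Lpi. h x = (\<lambda>_. 0) x"
  proof (rule Lpi.density_unique_banach[OF h])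
    fix A assume "A \<in> sets Lpi"
    then obtain X where X: "X \<in> sets borel" "A = {0..pi} \<inter> X"
      by (auto simp: Lpi_def sets_restrict_space)
    have "set_lebesgue_integral Lpi A h = 0" by (rule borel) (use X in simp)
    thus "set_lebesgue_integral Lpi A h = set_lebesgue_integral Lpi A (\<lambda>_. 0)"
      by (simp add: set_lebesgue_integral_def)
  qed simp
  thus ?thesis by simp
qed

text \<open>Orthogonality to all cos kx passes to all powers of cos x, hence to all polynomials in
  cos x. These are uniformly dense in the continuous functions on the interval, and uniform
  approximation is enough for a merely integrable h. Continuous ramps then give the initial
  integrals.\<close>

lemma cos_complete:
  fixes h :: "real \<Rightarrow> complex"
  assumes h: "integrable Lpi h"
    and orth: "\<And>k::nat. (\<integral>x. h x * complex_of_real (cos (real k * x)) \<partial>Lpi) = 0"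
  shows "AE x in Lpi. h x = 0"
proof -
  have int: "integrable Lpi (\<lambda>x. h x * complex_of_real (b x))"
    if b: "continuous_on UNIV b" for b :: "real \<Rightarrow> real"
  proof -
    obtain B where B: "\<And>x. x \<in> {0..pi} \<Longrightarrow> \<bar>b x\<bar> \<le> B"
      using continuous_bounded_Icc[OF b] by blast
    have "integrable Lpi (\<lambda>x. complex_of_real (b x) * h x)"
      by (rule integrable_bounded_mult[OF h, where B = B])
        (use B in \<open>auto simp: space_Lpi intro!: borel_measurable_Lpi_continuous continuous_intros b\<close>)
    thus ?thesis by (simp add: mult.commute)
  qed
  \<comment> \<open>The factor cos kx is carried along for the induction, since multiplying by cos x
    shifts k up and down; only \<open>k = 0\<close> is used afterwards.\<close>
  have powers: "(\<integral>x. h x * complex_of_real (cos x ^ n * cos (real k * x)) \<partial>Lpi) = 0" for n k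
  proof (induction n arbitrary: k)
    case 0
    show ?case using orth[of k] by simp
  next
    case (Suc n)
    \<comment> \<open>For \<open>k = 0\<close> the lower frequency is -1, which evenness of the
      cosine turns into 1; hence the case distinction on the index.\<close>
    have split: "cos x ^ Suc n * cos (real k * x)
        = 1/2 * (cos x ^ n * cos (real (Suc k) * x)) + 1/2 * (cos x ^ n * cos (real (if k = 0 then 1 else k - 1) * x))" for x
    proof (cases k)
      case 0
      thus ?thesis by simp
    next
      case [simp]: (Suc j)
      have "cos x * cos (real k * x) = (cos (real (Suc k) * x) + cos (real j * x)) / 2"
        unfolding cos_times_cos by (simp add: algebra_simps flip: cos_minus[of "x - (x + j * x)"])
      hence "cos x ^ n * (cos x * cos (real k * x)) = cos x ^ n * ((cos (real (Suc k) * x) + cos (real j * x)) / 2)"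
        by (rule arg_cong)
      thus ?thesis by (simp add: distrib_left add_divide_distrib mult_ac)
    qed
    have i: "integrable Lpi (\<lambda>x. h x * complex_of_real (cos x ^ n * cos (real m * x)))" for m
      by (intro int continuous_intros)
    have "h x * complex_of_real (cos x ^ Suc n * cos (real k * x))
      = 1/2 * (h x * complex_of_real (cos x ^ n * cos (real (Suc k) * x)))
      + 1/2 * (h x * complex_of_real (cos x ^ n * cos (real (if k = 0 then 1 else k - 1) * x)))" for x
      unfolding split of_real_add of_real_mult[of "1/2"] by (simp add: algebra_simps)
    hence "(\<integral>x. h x * complex_of_real (cos x ^ Suc n * cos (real k * x)) \<partial>Lpi)
      = 1/2 * (\<integral>x. h x * complex_of_real (cos x ^ n * cos (real (Suc k) * x)) \<partial>Lpi)
      + 1/2 * (\<integral>x. h x * complex_of_real (cos x ^ n * cos (real (if k = 0 then 1 else k - 1) * x)) \<partial>Lpi)"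
      by (simp only: Bochner_Integration.integral_add[OF integrable_mult_right[OF i] integrable_mult_right[OF i]]
          integral_mult_right_zero)
    thus ?case by (simp only: Suc.IH) simp
  qed
  have cont: "(\<integral>x. h x * complex_of_real (b x) \<partial>Lpi) = 0"
    if b: "continuous_on UNIV b" for b :: "real \<Rightarrow> real"
  proof -
    define H where "H = (\<integral>x. cmod (h x) \<partial>Lpi)"
    have H: "H \<ge> 0" by (simp add: H_def)
    have small: "cmod (\<integral>x. h x * complex_of_real (b x) \<partial>Lpi) \<le> \<epsilon> * H" if e: "\<epsilon> > 0" for \<epsilon>
    proof -
      \<comment> \<open>Since cos maps [0, pi] homeomorphically onto [-1, 1], Weierstrass
        approximation of \<open>b\<close> composed with \<open>arccos\<close> gives approximation of
        \<open>b\<close> by polynomials in cos x.\<close>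
      have "continuous_on {-1..1} (\<lambda>t. b (arccos t))"
        by (intro continuous_on_compose2[OF b] continuous_on_arccos' ) auto
      then obtain p where p: "real_polynomial_function p" "\<And>t. t \<in> {-1..1} \<Longrightarrow> \<bar>b (arccos t) - p t\<bar> < \<epsilon>"
        using Stone_Weierstrass_real_polynomial_function[of "{-1..1}" "\<lambda>t. b (arccos t)" \<epsilon>] e compact_Icc by blast
      from p(1) obtain a n where pa: "p = (\<lambda>t. \<Sum>i\<le>n. a i * t ^ i)"
        unfolding real_polynomial_function_iff_sum by blast
      have pc: "continuous_on UNIV (\<lambda>x. p (cos x))"
        unfolding pa by (intro continuous_intros)
      have approx: "\<bar>b x - p (cos x)\<bar> \<le> \<epsilon>" if "x \<in> {0..pi}" for x
        using p(2)[of "cos x"] that by (simp add: arccos_cos)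
      have i: "integrable Lpi (\<lambda>x. h x * complex_of_real (cos x ^ m))" for m
        by (intro int continuous_intros)
      have "(\<integral>x. h x * complex_of_real (p (cos x)) \<partial>Lpi)
          = (\<integral>x. (\<Sum>i\<le>n. complex_of_real (a i) * (h x * complex_of_real (cos x ^ i))) \<partial>Lpi)"
        by (simp add: pa sum_distrib_left mult_ac)
      also have "\<dots> = (\<Sum>i\<le>n. complex_of_real (a i) * (\<integral>x. h x * complex_of_real (cos x ^ i) \<partial>Lpi))"
        by (subst Bochner_Integration.integral_sum) (simp_all only: integral_mult_right_zero integrable_mult_right[OF i])
      also have "\<dots> = 0" using powers[of _ 0] by simp
      finally have "(\<integral>x. h x * complex_of_real (b x) \<partial>Lpi) = (\<integral>x. h x * complex_of_real (b x - p (cos x)) \<partial>Lpi)"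
        using Bochner_Integration.integral_diff[OF int[OF b] int[OF pc]] by (simp add: right_diff_distrib)
      also have "cmod \<dots> \<le> (\<integral>x. cmod (h x * complex_of_real (b x - p (cos x))) \<partial>Lpi)"
        by (rule integral_norm_bound)
      also have "\<dots> \<le> (\<integral>x. \<epsilon> * cmod (h x) \<partial>Lpi)"
      proof (rule integral_mono)
        show "integrable Lpi (\<lambda>x. cmod (h x * complex_of_real (b x - p (cos x))))"
          by (intro integrable_norm int continuous_intros b pc)
        show "integrable Lpi (\<lambda>x. \<epsilon> * cmod (h x))" using h by simp
        fix x assume "x \<in> space Lpi"
        hence "cmod (complex_of_real (b x - p (cos x))) \<le> \<epsilon>"
          unfolding norm_of_real by (intro approx) (simp add: space_Lpi)
        thus "cmod (h x * complex_of_real (b x - p (cos x))) \<le> \<epsilon> * cmod (h x)"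
          unfolding norm_mult by (subst mult.commute) (intro mult_right_mono, auto)
      qed
      finally show ?thesis by (simp add: H_def)
    qed
    have "cmod (\<integral>x. h x * complex_of_real (b x) \<partial>Lpi) \<le> 0"
    proof (rule field_le_epsilon)
      fix r :: real assume r: "0 < r"
      have "cmod (\<integral>x. h x * complex_of_real (b x) \<partial>Lpi) \<le> r / (H + 1) * H"
        using r H by (intro small) simp
      also have "\<dots> \<le> r" using r H by (simp add: field_simps)
      finally show "cmod (\<integral>x. h x * complex_of_real (b x) \<partial>Lpi) \<le> 0 + r" by simp
    qed
    thus ?thesis by simp
  qed
  have "primitive h a = 0" for a
  proof -
    \<comment> \<open>A ramp equal to 1 up to a and, for n \<ge> 1, falling to 0 on an interval of
      length 1/n; it converges pointwise to the indicator of x \<le> a, including the point a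
      itself.\<close>
    define b where "b n x = max 0 (min 1 (1 - real n * (x - a)))" for n x
    have bc: "continuous_on UNIV (b n)" for n
      unfolding b_def by (intro continuous_intros)
    have bb: "0 \<le> b n x" "b n x \<le> 1" for n x by (auto simp: b_def)
    have "(\<lambda>n. \<integral>x. h x * complex_of_real (b n x) \<partial>Lpi) \<longlonglongrightarrow> (\<integral>x. (if x \<le> a then h x else 0) \<partial>Lpi)"
    proof (rule integral_dominated_convergence[where w = "\<lambda>x. cmod (h x)"])
      show "(\<lambda>x. if x \<le> a then h x else 0) \<in> borel_measurable Lpi"
        using integrable_truncated[OF h] by auto
      show "(\<lambda>x. h x * complex_of_real (b n x)) \<in> borel_measurable Lpi" for n
        using int[OF bc] by auto
      show "integrable Lpi (\<lambda>x. cmod (h x))" using h by simp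
      show "AE x in Lpi. cmod (h x * complex_of_real (b n x)) \<le> cmod (h x)" for n
        using bb by (intro AE_I2) (auto simp: norm_mult intro: mult_left_le)
      show "AE x in Lpi. (\<lambda>n. h x * complex_of_real (b n x)) \<longlonglongrightarrow> (if x \<le> a then h x else 0)"
      proof (rule AE_I2)
        fix x
        show "(\<lambda>n. h x * complex_of_real (b n x)) \<longlonglongrightarrow> (if x \<le> a then h x else 0)"
        proof (cases "x \<le> a")
          case True
          hence "real n * (x - a) \<le> 0" for n by (simp add: mult_nonneg_nonpos)
          hence "b n x = 1" for n unfolding b_def by (smt (verit))
          thus ?thesis using True by simp
        next
          case False
          hence d: "x - a > 0" by simp
          obtain N where N: "real N * (x - a) > 1"
            using reals_Archimedean3[OF d] by blast
          have "b n x = 0" if "n \<ge> N" for n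
          proof -
            have "real N * (x - a) \<le> real n * (x - a)" using that d by (intro mult_right_mono) auto
            thus ?thesis using N unfolding b_def by linarith
          qed
          hence "eventually (\<lambda>n. h x * complex_of_real (b n x) = (if x \<le> a then h x else 0)) sequentially"
            using False by (intro eventually_sequentiallyI[of N]) simp
          thus ?thesis by (rule tendsto_eventually)
        qed
      qed
    qed
    thus ?thesis
      unfolding primitive_def using cont[OF bc] by (simp add: LIMSEQ_const_iff)
  qed
  thus ?thesis
    by (rule AE_zero_if_initial_integrals_zero[OF h])
qed

text \<open>The products sin x cos kx are combinations of sines, so h(x) sin x is orthogonal to
  every cosine and vanishes almost everywhere. As sin x > 0 inside the interval, h vanishes as
  well.\<close>

lemma sin_complete:
  fixes h :: "real \<Rightarrow> complex"
  assumes h: "integrable Lpi h"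
    and orth: "\<And>k::nat. (\<integral>x. h x * complex_of_real (sin (real (Suc k) * x)) \<partial>Lpi) = 0"
  shows "AE x in Lpi. h x = 0"
proof -
  have orth': "(\<integral>x. h x * complex_of_real (sin (real k * x)) \<partial>Lpi) = 0" for k
    by (cases k) (use orth in auto)
  have int: "integrable Lpi (\<lambda>x. h x * complex_of_real (sin (t * x)))" for t
    using integrable_bounded_mult[OF h, of "\<lambda>x. complex_of_real (sin (t * x))" 1]
    by (simp add: mult.commute[of _ "complex_of_real _"] borel_measurable_Lpi_continuous continuous_intros)
  have "AE x in Lpi. h x * complex_of_real (sin x) = 0"
  proof (rule cos_complete)
    show "integrable Lpi (\<lambda>x. h x * complex_of_real (sin x))" using int[of 1] by simp
    fix k :: nat
    \<comment> \<open>For \<open>k = 0\<close> the lower frequency is -1; by oddness of the sine its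
      term becomes sin x with the opposite sign.\<close>
    have "h x * complex_of_real (sin x) * complex_of_real (cos (real k * x))
       = 1/2 * (h x * complex_of_real (sin (real (Suc k) * x)))
       + 1/2 * (if k = 0 then 1 else -1) * (h x * complex_of_real (sin (real (if k = 0 then 1 else k - 1) * x)))" for x
    proof (cases k)
      case [simp]: (Suc j)
      have "sin x * cos (real k * x) = (sin (real (Suc k) * x) - sin (real j * x)) / 2"
        unfolding sin_times_cos by (simp add: algebra_simps)
      from arg_cong[OF this, of complex_of_real]
      have "complex_of_real (sin x) * complex_of_real (cos (real k * x))
          = (complex_of_real (sin (real (Suc k) * x)) - complex_of_real (sin (real j * x))) / 2"
        by (simp only: of_real_mult of_real_diff of_real_divide of_real_numeral)
      hence "h x * (complex_of_real (sin x) * complex_of_real (cos (real k * x)))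
          = h x * ((complex_of_real (sin (real (Suc k) * x)) - complex_of_real (sin (real j * x))) / 2)"
        by (rule arg_cong)
      thus ?thesis by (simp add: right_diff_distrib diff_divide_distrib mult.assoc)
    qed simp
    thus "(\<integral>x. h x * complex_of_real (sin x) * complex_of_real (cos (real k * x)) \<partial>Lpi) = 0"
      by (simp only: Bochner_Integration.integral_add[OF integrable_mult_right[OF int] integrable_mult_right[OF int]]
          integral_mult_right_zero orth') simp
  qed
  thus ?thesis
    using AE_Lpi_neq[of 0] AE_Lpi_neq[of pi] AE_space[of Lpi]
  proof eventually_elim
    case (elim x)
    hence "sin x > 0" by (intro sin_gt_zero) (auto simp: space_Lpi)
    with elim(1) show ?case by simp
  qed
qed

section \<open>The sine and cosine systems and the coefficients they define\<close>

lemma integral_cos_int: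
  "(\<integral>x. cos (real_of_int n * x) \<partial>Lpi) = (if n = 0 then pi else 0)"
proof (cases "n = 0")
  case True
  thus ?thesis by (simp add: measure_Lpi)
next
  case False
  have "(\<integral>x. cos (real_of_int n * x) \<partial>Lpi) = (\<integral>x. (if 0 \<le> x then cos (real_of_int n * x) else 0) \<partial>Lpi)"
    by (intro Bochner_Integration.integral_cong) (auto simp: space_Lpi)
  also have "\<dots> = sin (real_of_int n * pi) / real_of_int n - sin (real_of_int n * 0) / real_of_int n"
    using False by (intro integral_FTC_Lpi) (auto intro!: derivative_eq_intros continuous_intros)
  also have "\<dots> = 0" by (simp add: mult.commute[of _ pi])
  finally show ?thesis using False by simp
qed

lemma integrable_cos_int: "integrable Lpi (\<lambda>x. cos (real_of_int n * x))"
  by (rule Lpi.integrable_const_bound[where B = 1])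
    (auto intro!: borel_measurable_Lpi_continuous continuous_intros)

definition sine :: "nat \<Rightarrow> real \<Rightarrow> complex" where
  "sine k x = complex_of_real (sqrt 2 * sin (real k * x))"

definition dsine :: "nat \<Rightarrow> real \<Rightarrow> complex" where
  "dsine k x = complex_of_real (sqrt 2 * (real k * cos (real k * x)))"

text \<open>The constant 1 already has squared norm pi, so it must not carry the factor sqrt 2 of
  the other members.\<close>

definition cosine :: "nat \<Rightarrow> real \<Rightarrow> real" where
  "cosine k x = (if k = 0 then 1 else sqrt 2 * cos (real k * x))"

lemma sine_measurable [measurable]: "sine k \<in> borel_measurable Lpi"
  unfolding sine_def[abs_def] by (intro borel_measurable_Lpi_continuous continuous_intros)

lemma dsine_measurable [measurable]: "dsine k \<in> borel_measurable Lpi"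
  unfolding dsine_def[abs_def] by (intro borel_measurable_Lpi_continuous continuous_intros)

lemma sine_bounded: "cmod (sine k x) \<le> sqrt 2"
  unfolding sine_def norm_of_real by (simp add: abs_mult)

lemma dsine_bounded: "cmod (dsine k x) \<le> sqrt 2 * real k"
  unfolding dsine_def norm_of_real by (simp add: abs_mult mult_left_le)

lemma integrable_mult_sine: "integrable Lpi h \<Longrightarrow> integrable Lpi (\<lambda>x. h x * sine k x)"
  using integrable_bounded_mult[OF _ sine_measurable sine_bounded] by (simp add: mult.commute)

lemma integrable_mult_dsine: "integrable Lpi h \<Longrightarrow> integrable Lpi (\<lambda>x. h x * dsine k x)"
  using integrable_bounded_mult[OF _ dsine_measurable dsine_bounded] by (simp add: mult.commute)

lemma square_integrable_mult_sine:
  "square_integrable Lpi h \<Longrightarrow> square_integrable Lpi (\<lambda>x. h x * sine k x)"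
  using square_integrable_bounded_mult[OF _ sine_measurable sine_bounded] by (simp add: mult.commute)

lemma square_integrable_mult_dsine:
  "square_integrable Lpi h \<Longrightarrow> square_integrable Lpi (\<lambda>x. h x * dsine k x)"
  using square_integrable_bounded_mult[OF _ dsine_measurable dsine_bounded] by (simp add: mult.commute)

lemma sqrt2_mult: "sqrt 2 * a * (sqrt 2 * b) = 2 * (a * b)" for a b :: real
proof -
  have "sqrt 2 * a * (sqrt 2 * b) = (sqrt 2 * sqrt 2) * (a * b)" by (simp only: mult_ac)
  thus ?thesis by simp
qed

text \<open>The shift by \<open>Suc\<close> reflects that sequences are indexed by k \<ge> 1, as in
  \<open>l2\<close>; index 0 would give the zero function and break orthogonality.\<close>

interpretation Sin: orthogonal_system Lpi "\<lambda>k x. sqrt 2 * sin (real (Suc k) * x)" pi "sqrt 2"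
proof unfold_locales
  fix i j :: nat
  have "sqrt 2 * sin (real (Suc i) * x) * (sqrt 2 * sin (real (Suc j) * x))
      = cos (real_of_int (int i - int j) * x) - cos (real_of_int (int i + int j + 2) * x)" for x
    unfolding sqrt2_mult
    using sin_times_sin[of "real (Suc i) * x" "real (Suc j) * x"] by (simp add: algebra_simps)
  thus "(\<integral>x. sqrt 2 * sin (real (Suc i) * x) * (sqrt 2 * sin (real (Suc j) * x)) \<partial>Lpi) = (if i = j then pi else 0)"
    by (simp only: Bochner_Integration.integral_diff[OF integrable_cos_int integrable_cos_int] integral_cos_int)
      (auto simp: nat_int_add)
qed (auto simp: abs_mult intro!: borel_measurable_Lpi_continuous continuous_intros)

interpretation Cos: orthogonal_system Lpi cosine pi "sqrt 2"
proof unfold_locales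
  fix i j :: nat
  have c: "(\<integral>x. cos (real m * x) \<partial>Lpi) = (if m = 0 then pi else 0)" for m
    using integral_cos_int[of "int m"] by simp
  show "(\<integral>x. cosine i x * cosine j x \<partial>Lpi) = (if i = j then pi else 0)"
  proof (cases "i = 0 \<or> j = 0")
    case True
    thus ?thesis
      by (auto simp: cosine_def measure_Lpi c)
  next
    case False
    have "cosine i x * cosine j x = cos (real_of_int (int i - int j) * x) + cos (real_of_int (int i + int j) * x)" for x
      using False cos_times_cos[of "real i * x" "real j * x"] by (simp add: cosine_def sqrt2_mult) (simp add: algebra_simps)
    thus ?thesis using False
      by (simp only: Bochner_Integration.integral_add[OF integrable_cos_int integrable_cos_int] integral_cos_int) auto
  qed
next
  fix k show "cosine k \<in> borel_measurable Lpi"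
    unfolding cosine_def[abs_def] by (cases "k = 0") (auto intro!: borel_measurable_Lpi_continuous continuous_intros)
qed (auto simp: cosine_def abs_mult)

lemma fourier_sine: "fourier f k = complex_of_real (1 / pi) * (\<integral>x. f x * sine k x \<partial>Lpi)"
  by (simp add: fourier_def ip_def set_integral_Lpi sine_def)

lemma integral_sine: "(\<integral>x. f x * sine k x \<partial>Lpi) = complex_of_real pi * fourier f k"
  by (simp add: fourier_sine)

lemma fourier_0: "fourier f 0 = 0"
  by (simp add: fourier_sine sine_def)

lemma coeff_Sin: "Sin.coeff f k = fourier f (Suc k)"
  unfolding Sin.coeff_def fourier_sine sine_def ..

lemma fourier_cong_AE:
  assumes "AE x in Lpi. f x = g x" "f \<in> borel_measurable Lpi" "g \<in> borel_measurable Lpi"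
  shows "fourier f = fourier g"
proof
  fix k
  note [measurable] = assms(2,3)
  have "(\<integral>x. f x * sine k x \<partial>Lpi) = (\<integral>x. g x * sine k x \<partial>Lpi)"
    by (rule integral_cong_AE) (use assms(1) in \<open>measurable, auto\<close>)
  thus "fourier f k = fourier g k" by (simp add: fourier_sine)
qed

lemma fourier_inject:
  assumes f: "square_integrable Lpi f" and g: "square_integrable Lpi g"
    and eq: "\<And>k. fourier f (Suc k) = fourier g (Suc k)"
  shows "AE x in Lpi. f x = g x"
proof -
  note int = Lpi.square_integrable_integrable[OF f] Lpi.square_integrable_integrable[OF g]
  have "AE x in Lpi. f x - g x = 0"
  proof (rule sin_complete)
    show "integrable Lpi (\<lambda>x. f x - g x)" using int by simp
    fix k
    have "(\<integral>x. (f x - g x) * sine (Suc k) x \<partial>Lpi) = 0"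
      using int[THEN integrable_mult_sine, of "Suc k"] eq[of k]
      by (simp add: left_diff_distrib integral_sine)
    also have "(\<integral>x. (f x - g x) * sine (Suc k) x \<partial>Lpi)
        = (\<integral>x. complex_of_real (sqrt 2) * ((f x - g x) * complex_of_real (sin (real (Suc k) * x))) \<partial>Lpi)"
      by (simp only: sine_def of_real_mult mult_ac)
    finally show "(\<integral>x. (f x - g x) * complex_of_real (sin (real (Suc k) * x)) \<partial>Lpi) = 0"
      by (simp only: integral_mult_right_zero) simp
  qed
  thus ?thesis by simp
qed

lemma integral_dsine_zero: "(\<integral>x. dsine k x \<partial>Lpi) = 0"
proof -
  have "(\<integral>x. dsine k x \<partial>Lpi) = complex_of_real (\<integral>x. sqrt 2 * (real k * cos (real k * x)) \<partial>Lpi)"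
    unfolding dsine_def by (rule integral_complex_of_real)
  also have "\<dots> = 0" using integral_cos_int[of "int k"] by simp
  finally show ?thesis .
qed

text \<open>A du Bois-Reymond lemma with the derivatives of the sines as test functions. They have
  mean zero, so subtracting the mean of h keeps the hypothesis and supplies the missing condition
  for \<open>k = 0\<close>.\<close>

lemma AE_const_if_cos_zero:
  assumes h: "integrable Lpi h"
    and zero: "\<And>k. (\<integral>x. h x * dsine (Suc k) x \<partial>Lpi) = 0"
  shows "\<exists>c. AE x in Lpi. h x = c"
proof -
  define c where "c = (\<integral>x. h x \<partial>Lpi) / complex_of_real pi"
  have "AE x in Lpi. h x - c = 0"
  proof (rule cos_complete)
    show "integrable Lpi (\<lambda>x. h x - c)" using h by simp
    fix k :: nat
    show "(\<integral>x. (h x - c) * complex_of_real (cos (real k * x)) \<partial>Lpi) = 0"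
    proof (cases k)
      case 0
      thus ?thesis using h by (simp add: c_def measure_Lpi scaleR_conv_of_real)
    next
      case (Suc j)
      define s where "s = complex_of_real (sqrt 2 * real k)"
      have s: "s \<noteq> 0" using Suc unfolding s_def of_real_eq_0_iff by simp
      have "(\<integral>x. (h x - c) * dsine k x \<partial>Lpi) = 0"
        using zero[of j] integrable_mult_dsine[OF h, of k] integrable_mult_dsine[of "\<lambda>_. c" k]
        by (simp add: left_diff_distrib integral_dsine_zero Suc)
      also have "(\<integral>x. (h x - c) * dsine k x \<partial>Lpi) = (\<integral>x. s * ((h x - c) * complex_of_real (cos (real k * x))) \<partial>Lpi)"
        by (simp only: s_def dsine_def of_real_mult mult_ac)
      finally show ?thesis using s by (simp only: integral_mult_right_zero) simp
    qed
  qed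
  thus ?thesis by (intro exI[of _ c]) simp
qed

lemma coeff_Cos_inject:
  assumes f: "square_integrable Lpi f" and g: "square_integrable Lpi g"
    and eq: "Cos.coeff f = Cos.coeff g"
  shows "AE x in Lpi. f x = g x"
proof -
  note int = Lpi.square_integrable_integrable[OF f] Lpi.square_integrable_integrable[OF g]
  have "AE x in Lpi. f x - g x = 0"
  proof (rule cos_complete)
    show "integrable Lpi (\<lambda>x. f x - g x)" using int by simp
    fix k :: nat
    define s where "s = complex_of_real (if k = 0 then 1 else sqrt 2)"
    have s: "s \<noteq> 0" by (simp add: s_def)
    have "(\<integral>x. f x * complex_of_real (cosine k x) \<partial>Lpi) = (\<integral>x. g x * complex_of_real (cosine k x) \<partial>Lpi)"
      using fun_cong[OF eq, of k] by (simp add: Cos.coeff_def)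
    hence "(\<integral>x. (f x - g x) * complex_of_real (cosine k x) \<partial>Lpi) = 0"
      using f g by (simp add: left_diff_distrib square_integrable_mult Cos.square_integrable_e)
    also have "(\<integral>x. (f x - g x) * complex_of_real (cosine k x) \<partial>Lpi)
        = (\<integral>x. s * ((f x - g x) * complex_of_real (cos (real k * x))) \<partial>Lpi)"
      by (simp add: cosine_def s_def mult_ac)
    finally show "(\<integral>x. (f x - g x) * complex_of_real (cos (real k * x)) \<partial>Lpi) = 0"
      using s by (simp only: integral_mult_right_zero) simp
  qed
  thus ?thesis by simp
qed

section \<open>The Dirichlet operator in Fourier coordinates\<close>

text \<open>The boundary term vanishes because sin(k pi) = 0, whatever the primitive does at pi.
  This suits the quasi-derivative, on which no boundary values are imposed.\<close>

lemma integral_primitive_dsine: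
  assumes "integrable Lpi w"
  shows "(\<integral>x. primitive w x * dsine k x \<partial>Lpi) = - (\<integral>x. w x * sine k x \<partial>Lpi)"
  unfolding sine_def dsine_def
  by (subst integration_by_parts_primitive[OF assms, where F = "\<lambda>x. sqrt 2 * sin (real k * x)"])
    (auto intro!: derivative_eq_intros continuous_intros)

lemma square_integrable_primitive:
  assumes "integrable Lpi w"
  shows "square_integrable Lpi (primitive w)"
  using assms primitive_bounded[OF assms] by (intro Lpi.square_integrable_bounded) auto

text \<open>Here cos(k pi) is nonzero and the boundary term vanishes because g has mean zero, i.e.
  the primitive returns to 0 at pi. The weight in \<open>l2k\<close> thus expresses square
  integrability of y'.\<close>

lemma coeff_Cos_derivative:
  assumes g: "integrable Lpi g" and g0: "(\<integral>x. g x \<partial>Lpi) = 0"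
  shows "Cos.coeff g k = of_nat k * fourier (primitive g) k"
proof (cases "k = 0")
  case True
  thus ?thesis using g0 by (simp add: Cos.coeff_def cosine_def)
next
  case False
  have "(\<integral>x. primitive g x * complex_of_real (- sqrt 2 * (real k * sin (real k * x))) \<partial>Lpi)
      = - (\<integral>x. g x * complex_of_real (sqrt 2 * cos (real k * x)) \<partial>Lpi)"
    by (subst integration_by_parts_primitive[OF g, where F = "\<lambda>x. sqrt 2 * cos (real k * x)"])
      (auto intro!: derivative_eq_intros continuous_intros simp: primitive_pi g0)
  also have "(\<integral>x. primitive g x * complex_of_real (- sqrt 2 * (real k * sin (real k * x))) \<partial>Lpi)
      = (\<integral>x. - of_nat k * (primitive g x * sine k x) \<partial>Lpi)"
    by (simp add: sine_def mult_ac)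
  finally show ?thesis using False
    by (simp add: Cos.coeff_def cosine_def integral_sine) (simp add: field_simps)
qed

lemma integral_dsine:
  assumes g: "integrable Lpi g" and g0: "(\<integral>x. g x \<partial>Lpi) = 0" and k: "k \<noteq> 0"
  shows "(\<integral>x. g x * dsine k x \<partial>Lpi) = complex_of_real pi * (of_nat (k\<^sup>2) * fourier (primitive g) k)"
proof -
  have "(\<integral>x. g x * dsine k x \<partial>Lpi) = (\<integral>x. of_nat k * (g x * complex_of_real (cosine k x)) \<partial>Lpi)"
    using k by (simp add: dsine_def cosine_def mult_ac)
  also have "\<dots> = of_nat k * (complex_of_real pi * Cos.coeff g k)"
    by (simp add: Cos.coeff_def)
  finally show ?thesis
    by (simp add: coeff_Cos_derivative[OF g g0] power2_eq_square mult_ac)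
qed

text \<open>Formally this is the pairing of Q' with cos nx, the derivative having been moved to the
  cosine; hence the weight n in \<open>Vt\<close>. The constant is pi from the inner product over
  sqrt 2 from the normalised sine.\<close>

lemma integral_Vt:
  "(\<integral>x. Q x * complex_of_real (real n * sin (real n * x)) \<partial>Lpi) = complex_of_real (pi / sqrt 2) * Vt Q n"
proof -
  have "(\<integral>x. Q x * complex_of_real (real n * sin (real n * x)) \<partial>Lpi)
      = (\<integral>x. complex_of_real (real n / sqrt 2) * (Q x * sine n x) \<partial>Lpi)"
    by (simp add: sine_def mult_ac)
  thus ?thesis by (simp add: integral_sine Vt_def qt_def)
qed

text \<open>\<open>2 m cos mx sin kx + 2 k sin mx cos kx\<close> is the derivative of
  \<open>2 sin mx sin kx = cos (k - m)x - cos (k + m)x\<close>.\<close>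

lemma integral_product_rule:
  assumes Q: "square_integrable Lpi Q"
  shows "of_nat m * (\<integral>x. complex_of_real (sqrt 2 * cos (real m * x)) * (Q x * sine k x) \<partial>Lpi)
    + (\<integral>x. sine m x * (Q x * dsine k x) \<partial>Lpi)
    = complex_of_real (pi / sqrt 2) * (Vt Q (k + m) - Vt Q (absdiff k m))"
proof -
  have c: "square_integrable Lpi (\<lambda>x. complex_of_real (sqrt 2 * cos (real m * x)))"
    by (rule Lpi.square_integrable_bounded[where B = "sqrt 2"])
      (auto intro!: borel_measurable_Lpi_continuous continuous_intros simp: norm_mult)
  have s: "square_integrable Lpi (sine m)"
    by (rule Lpi.square_integrable_bounded[OF sine_measurable sine_bounded])
  have i: "integrable Lpi (\<lambda>x. Q x * complex_of_real (real n * sin (real n * x)))" for n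
  proof (rule square_integrable_mult[OF Q], rule Lpi.square_integrable_bounded[where B = "real n"])
    show "cmod (complex_of_real (real n * sin (real n * x))) \<le> real n" for x
      unfolding norm_of_real by (simp add: abs_mult mult_left_le)
  qed (intro borel_measurable_Lpi_continuous continuous_intros)
  have trig: "2 * real m * (cos (real m * x) * sin (real k * x)) + 2 * real k * (sin (real m * x) * cos (real k * x))
      = real (k + m) * sin (real (k + m) * x) - real (absdiff k m) * sin (real (absdiff k m) * x)" for x
  proof -
    \<comment> \<open>The function t sin(tx) is even in t, so the absolute difference may be
      replaced by k - m.\<close>
    have "real (absdiff k m) * sin (real (absdiff k m) * x) = (real k - real m) * sin (real k * x - real m * x)"
    proof (cases "m \<le> k")
      case True
      thus ?thesis by (simp add: absdiff_def of_nat_diff left_diff_distrib)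
    next
      case False
      hence "real (absdiff k m) = - (real k - real m)" by (simp add: absdiff_def of_nat_diff)
      thus ?thesis using sin_minus[of "(real k - real m) * x"] by (simp add: left_diff_distrib)
    qed
    thus ?thesis by (simp add: sin_add sin_diff algebra_simps)
  qed
  have pt: "of_nat m * (complex_of_real (sqrt 2 * cos (real m * x)) * (Q x * sine k x)) + sine m x * (Q x * dsine k x)
      = Q x * complex_of_real (real (k + m) * sin (real (k + m) * x))
      - Q x * complex_of_real (real (absdiff k m) * sin (real (absdiff k m) * x))" for x
  proof -
    have r: "of_real (sqrt 2) * of_real (sqrt 2) = (2::complex)"
      by (simp flip: of_real_mult)
    have "of_nat m * (complex_of_real (sqrt 2 * cos (real m * x)) * (Q x * sine k x)) + sine m x * (Q x * dsine k x)
      = (of_real (sqrt 2) * of_real (sqrt 2)) * Q x * (of_nat m * (of_real (cos (real m * x)) * of_real (sin (real k * x)))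
         + of_nat k * (of_real (sin (real m * x)) * of_real (cos (real k * x))))"
      unfolding sine_def dsine_def of_real_mult of_real_of_nat_eq by (simp only: algebra_simps)
    also have "\<dots> = Q x * complex_of_real (2 * real m * (cos (real m * x) * sin (real k * x)) + 2 * real k * (sin (real m * x) * cos (real k * x)))"
      unfolding r by (simp add: algebra_simps)
    finally show ?thesis unfolding trig by (simp only: of_real_diff right_diff_distrib)
  qed
  have "of_nat m * (\<integral>x. complex_of_real (sqrt 2 * cos (real m * x)) * (Q x * sine k x) \<partial>Lpi)
    + (\<integral>x. sine m x * (Q x * dsine k x) \<partial>Lpi)
    = (\<integral>x. of_nat m * (complex_of_real (sqrt 2 * cos (real m * x)) * (Q x * sine k x)) + sine m x * (Q x * dsine k x) \<partial>Lpi)"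
    by (subst Bochner_Integration.integral_add)
      (simp_all only: integral_mult_right_zero integrable_mult_right
        square_integrable_mult[OF c square_integrable_mult_sine[OF Q]]
        square_integrable_mult[OF s square_integrable_mult_dsine[OF Q]])
  also have "\<dots> = complex_of_real (pi / sqrt 2) * (Vt Q (k + m) - Vt Q (absdiff k m))"
    unfolding pt by (simp only: Bochner_Integration.integral_diff[OF i i] integral_Vt right_diff_distrib)
  finally show ?thesis .
qed

text \<open>Expanding \<open>g = y'\<close> in cosines and \<open>y\<close> in sines reduces the pairing of \<open>Q\<close> with the
  derivative of \<open>y sin kx\<close> to the previous lemma, term by term.\<close>

lemma Ld_sums:
  assumes Q: "square_integrable Lpi Q" and g: "square_integrable Lpi g" and g0: "(\<integral>x. g x \<partial>Lpi) = 0"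
  shows "(\<lambda>m. Ld_term Q (fourier (primitive g)) k (Suc m)) sums
    (- complex_of_real (sqrt 2 / pi) *
      ((\<integral>x. g x * (Q x * sine k x) \<partial>Lpi) + (\<integral>x. primitive g x * (Q x * dsine k x) \<partial>Lpi)))"
proof -
  define z where "z = fourier (primitive g)"
  note gi = Lpi.square_integrable_integrable[OF g]
  have "(\<lambda>m. Cos.coeff g m * (\<integral>x. complex_of_real (cosine m x) * (Q x * sine k x) \<partial>Lpi))
      sums (\<integral>x. g x * (Q x * sine k x) \<partial>Lpi)"
    by (rule Cos.parseval[OF g square_integrable_mult_sine[OF Q]]) (rule coeff_Cos_inject[OF _ g])
  \<comment> \<open>The term of index 0 drops out because g has mean zero; the cosine series now
    runs over the same indices as the sine series.\<close>
  hence "(\<lambda>m. Cos.coeff g (Suc m) * (\<integral>x. complex_of_real (cosine (Suc m) x) * (Q x * sine k x) \<partial>Lpi))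
      sums (\<integral>x. g x * (Q x * sine k x) \<partial>Lpi)"
    by (subst sums_Suc_iff) (simp add: coeff_Cos_derivative[OF gi g0])
  hence 1: "(\<lambda>m. z (Suc m) * (of_nat (Suc m) * (\<integral>x. complex_of_real (sqrt 2 * cos (real (Suc m) * x)) * (Q x * sine k x) \<partial>Lpi)))
      sums (\<integral>x. g x * (Q x * sine k x) \<partial>Lpi)"
    by (simp only: coeff_Cos_derivative[OF gi g0] cosine_def z_def mult_ac nat.simps if_False)
  have "(\<lambda>m. Sin.coeff (primitive g) m * (\<integral>x. complex_of_real (sqrt 2 * sin (real (Suc m) * x)) * (Q x * dsine k x) \<partial>Lpi))
      sums (\<integral>x. primitive g x * (Q x * dsine k x) \<partial>Lpi)"
    by (rule Sin.parseval[OF square_integrable_primitive[OF gi] square_integrable_mult_dsine[OF Q]])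
      (auto intro!: fourier_inject square_integrable_primitive[OF gi] simp flip: coeff_Sin)
  hence 2: "(\<lambda>m. z (Suc m) * (\<integral>x. sine (Suc m) x * (Q x * dsine k x) \<partial>Lpi))
      sums (\<integral>x. primitive g x * (Q x * dsine k x) \<partial>Lpi)"
    by (simp only: coeff_Sin z_def sine_def)
  define I where "I = (\<integral>x. g x * (Q x * sine k x) \<partial>Lpi) + (\<integral>x. primitive g x * (Q x * dsine k x) \<partial>Lpi)"
  \<comment> \<open>Both series carry the factor \<open>z (Suc m)\<close>, one with the weight m + 1
    gained by differentiation, so the bracket is exactly the product rule integral.\<close>
  have "(\<lambda>m. z (Suc m) * (complex_of_real (pi / sqrt 2) * (Vt Q (k + Suc m) - Vt Q (absdiff k (Suc m))))) sums I"
    using sums_add[OF 1 2] unfolding distrib_left[symmetric] integral_product_rule[OF Q] I_def .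
  hence "(\<lambda>m. - complex_of_real (sqrt 2 / pi) * (z (Suc m) * (complex_of_real (pi / sqrt 2) * (Vt Q (k + Suc m) - Vt Q (absdiff k (Suc m))))))
      sums (- complex_of_real (sqrt 2 / pi) * I)"
    by (rule sums_mult)
  also have "(\<lambda>m. - complex_of_real (sqrt 2 / pi) * (z (Suc m) * (complex_of_real (pi / sqrt 2) * (Vt Q (k + Suc m) - Vt Q (absdiff k (Suc m))))))
      = (\<lambda>m. Ld_term Q z k (Suc m))"
  proof
    fix m
    have "complex_of_real (sqrt 2 / pi) * complex_of_real (pi / sqrt 2) = 1"
      by (simp flip: of_real_mult)
    thus "- complex_of_real (sqrt 2 / pi) * (z (Suc m) * (complex_of_real (pi / sqrt 2) * (Vt Q (k + Suc m) - Vt Q (absdiff k (Suc m)))))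
       = Ld_term Q z k (Suc m)"
      unfolding Ld_term_def by algebra
  qed
  finally show ?thesis unfolding z_def I_def .
qed

text \<open>The right-hand side is the weak form of \<ell>(y) tested against \<open>sine k\<close>,
  with y = \<open>primitive g\<close> and y' = g. No f occurs in it, so it serves both
  inclusions.\<close>

lemma Ld_eq:
  assumes Q: "square_integrable Lpi Q" and g: "square_integrable Lpi g" and g0: "(\<integral>x. g x \<partial>Lpi) = 0"
    and k: "k \<noteq> 0"
  shows "complex_of_real pi * Ld Q C (fourier (primitive g)) k
    = (\<integral>x. g x * dsine k x \<partial>Lpi) - (\<integral>x. primitive g x * (Q x * dsine k x) \<partial>Lpi)
      - (\<integral>x. g x * (Q x * sine k x) \<partial>Lpi) + C * (\<integral>x. primitive g x * sine k x \<partial>Lpi)"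
proof -
  define I where "I = (\<integral>x. g x * (Q x * sine k x) \<partial>Lpi) + (\<integral>x. primitive g x * (Q x * dsine k x) \<partial>Lpi)"
  \<comment> \<open>The prefactor of the matrix sum and the constant in \<open>Ld_sums\<close>
    combine to 1 / pi, the normalisation of the inner product.\<close>
  have "complex_of_real (1 / sqrt 2) * (- complex_of_real (sqrt 2 / pi) * I) = - (I / complex_of_real pi)"
    by simp
  with Ld_sums[OF Q g g0, of k]
  have "Ld Q C (fourier (primitive g)) k = of_nat (k\<^sup>2) * fourier (primitive g) k
      - I / complex_of_real pi + C * fourier (primitive g) k"
    using k unfolding Ld_def I_def[symmetric] by (simp add: sums_iff)
  thus ?thesis
    by (simp add: integral_dsine[OF Lpi.square_integrable_integrable[OF g] g0 k] integral_sine I_def field_simps)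
qed

section \<open>Comparison of the two operators and of their domains\<close>

lemma LDir_graphD:
  assumes Q: "square_integrable Lpi Q" and graph: "LDir_graph Q C y f"
  obtains g where "square_integrable Lpi g" "(\<integral>x. g x \<partial>Lpi) = 0"
    "\<And>x. x \<in> {0..pi} \<Longrightarrow> y x = primitive g x" "square_integrable Lpi f"
    "fourier f = Ld Q C (fourier (primitive g))"
proof -
  from graph obtain g u w where
    y: "L2_on y" and g: "L2_on g" and yg: "\<forall>x\<in>{0..pi}. y x = y 0 + (LINT t:{0..x}|lborel. g t)"
    and w: "set_integrable lborel {0..pi} w" and uw: "\<forall>x\<in>{0..pi}. u x = u 0 + (LINT t:{0..x}|lborel. w t)"
    and gu: "AE x in lborel. x \<in> {0..pi} \<longrightarrow> g x - Q x * y x = u x"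
    and y0: "y 0 = 0" "y pi = 0" and f: "L2_on f"
    and fw: "AE x in lborel. x \<in> {0..pi} \<longrightarrow> f x = - w x - Q x * g x + C * y x"
    unfolding LDir_graph_def by (elim exE conjE) (rule that; assumption)
  have g: "square_integrable Lpi g" and f: "square_integrable Lpi f"
    using g f by (auto simp: L2_on_iff)
  have w: "integrable Lpi w" using w by (simp add: set_integrable_Lpi)
  note gi = Lpi.square_integrable_integrable[OF g] and fi = Lpi.square_integrable_integrable[OF f]
  have yp: "y x = primitive g x" if "x \<in> {0..pi}" for x
    using yg y0 that by (simp add: set_integral_primitive)
  have g0: "(\<integral>x. g x \<partial>Lpi) = 0" using yp[of pi] y0 by (simp add: primitive_pi)
  have up: "u x = u 0 + primitive w x" if "x \<in> {0..pi}" for x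
    using uw that by (metis set_integral_primitive)
  have p: "square_integrable Lpi (primitive g)" by (rule square_integrable_primitive[OF gi])
  note Qp = square_integrable_mult[OF Q p] and Qg = square_integrable_mult[OF Q g]
    and pint = Lpi.square_integrable_integrable[OF p]
  have AE_w: "AE x in Lpi. w x = - f x - Q x * g x + C * primitive g x"
    using fw[unfolded AE_Lpi] AE_space[of Lpi]
    by eventually_elim (simp add: yp space_Lpi)
  have AE_p: "AE x in Lpi. primitive w x = g x - Q x * primitive g x - u 0"
    using gu[unfolded AE_Lpi] AE_space[of Lpi]
  proof eventually_elim
    case (elim x)
    hence x: "x \<in> {0..pi}" by (simp add: space_Lpi)
    show ?case using elim(1) yp[OF x] up[OF x] by (simp add: algebra_simps)
  qed
  note [measurable] = borel_measurable_integrable[OF w] borel_measurable_integrable[OF gi]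
    borel_measurable_integrable[OF fi] square_integrable_measurable[OF Q]
  have "fourier f k = Ld Q C (fourier (primitive g)) k" for k
  proof (cases "k = 0")
    case True
    thus ?thesis by (simp add: fourier_0 Ld_def)
  next
    case False
    have "(\<integral>x. w x * sine k x \<partial>Lpi) = (\<integral>x. - (f x * sine k x) - (Q x * g x) * sine k x + C * (primitive g x * sine k x) \<partial>Lpi)"
      by (rule integral_cong_AE) (measurable, use AE_w in eventually_elim, algebra)
    also have "\<dots> = - (\<integral>x. f x * sine k x \<partial>Lpi) - (\<integral>x. (Q x * g x) * sine k x \<partial>Lpi) + C * (\<integral>x. primitive g x * sine k x \<partial>Lpi)"
      using integrable_mult_sine[OF fi] integrable_mult_sine[OF Qg] integrable_mult_sine[OF pint] by simp
    finally have 1: "(\<integral>x. w x * sine k x \<partial>Lpi) = \<dots>" .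
    \<comment> \<open>The unknown initial value \<open>u 0\<close> of the quasi-derivative
      disappears because \<open>dsine k\<close> has mean zero.\<close>
    have "(\<integral>x. primitive w x * dsine k x \<partial>Lpi)
        = (\<integral>x. g x * dsine k x - (Q x * primitive g x) * dsine k x - u 0 * dsine k x \<partial>Lpi)"
      by (rule integral_cong_AE) (measurable, use AE_p in eventually_elim, algebra)
    also have "\<dots> = (\<integral>x. g x * dsine k x \<partial>Lpi) - (\<integral>x. (Q x * primitive g x) * dsine k x \<partial>Lpi)"
      using integrable_mult_dsine[OF gi] integrable_mult_dsine[OF Qp] integrable_mult_dsine[of "\<lambda>_. u 0"] by (simp add: integral_dsine_zero)
    finally have 2: "(\<integral>x. primitive w x * dsine k x \<partial>Lpi) = \<dots>" .
    have "complex_of_real pi * fourier f k = complex_of_real pi * Ld Q C (fourier (primitive g)) k"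
      unfolding Ld_eq[OF Q g g0 False] integral_sine[symmetric]
      using 1 2 integral_primitive_dsine[OF w, of k] by (simp add: mult_ac)
    thus ?thesis by simp
  qed
  hence "fourier f = Ld Q C (fourier (primitive g))" by blast
  with that g g0 yp f show thesis by blast
qed

lemma primitive_in_DDir:
  assumes Q: "square_integrable Lpi Q" and g: "square_integrable Lpi g" and g0: "(\<integral>x. g x \<partial>Lpi) = 0"
    and f: "square_integrable Lpi f" and Ld: "\<And>k. fourier f (Suc k) = Ld Q C (fourier (primitive g)) (Suc k)"
  shows "primitive g \<in> DDir Q C"
proof -
  note gi = Lpi.square_integrable_integrable[OF g] and fi = Lpi.square_integrable_integrable[OF f]
  have p: "square_integrable Lpi (primitive g)" by (rule square_integrable_primitive[OF gi])
  note Qp = square_integrable_mult[OF Q p] and Qg = square_integrable_mult[OF Q g]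
    and pint = Lpi.square_integrable_integrable[OF p]
  \<comment> \<open>The equation f = - w - Q y' + C y solved for the derivative of the
    quasi-derivative.\<close>
  define w where "w x = - f x - Q x * g x + C * primitive g x" for x
  have w: "integrable Lpi w" unfolding w_def using fi Qg pint by simp
  have pw: "integrable Lpi (primitive w)"
    by (rule Lpi.square_integrable_integrable[OF square_integrable_primitive[OF w]])
  \<comment> \<open>The quasi-derivative minus its candidate primitive. Its constant value c becomes
    the initial value, with \<open>c + primitive w\<close> as the absolutely continuous
    representative.\<close>
  define h where "h x = g x - Q x * primitive g x - primitive w x" for x
  have "\<exists>c. AE x in Lpi. h x = c"
  proof (rule AE_const_if_cos_zero)
    show "integrable Lpi h" unfolding h_def using gi Qp pw by simp
    fix k
    have "(\<integral>x. h x * dsine (Suc k) x \<partial>Lpi) = (\<integral>x. g x * dsine (Suc k) x \<partial>Lpi)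
        - (\<integral>x. (Q x * primitive g x) * dsine (Suc k) x \<partial>Lpi) + (\<integral>x. w x * sine (Suc k) x \<partial>Lpi)"
      unfolding h_def left_diff_distrib
      using integrable_mult_dsine[OF gi] integrable_mult_dsine[OF Qp] integrable_mult_dsine[OF pw]
      by (simp add: integral_primitive_dsine[OF w])
    also have "(\<integral>x. w x * sine (Suc k) x \<partial>Lpi)
        = (\<integral>x. - (f x * sine (Suc k) x) - (Q x * g x) * sine (Suc k) x + C * (primitive g x * sine (Suc k) x) \<partial>Lpi)"
      by (simp add: w_def algebra_simps)
    also have "\<dots> = - (\<integral>x. f x * sine (Suc k) x \<partial>Lpi) - (\<integral>x. (Q x * g x) * sine (Suc k) x \<partial>Lpi)
        + C * (\<integral>x. primitive g x * sine (Suc k) x \<partial>Lpi)"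
      using integrable_mult_sine[OF fi] integrable_mult_sine[OF Qg] integrable_mult_sine[OF pint] by simp
    also have "(\<integral>x. f x * sine (Suc k) x \<partial>Lpi) = complex_of_real pi * Ld Q C (fourier (primitive g)) (Suc k)"
      unfolding integral_sine Ld ..
    finally show "(\<integral>x. h x * dsine (Suc k) x \<partial>Lpi) = 0"
      unfolding Ld_eq[OF Q g g0 Suc_not_Zero] by (simp add: mult_ac)
  qed
  then obtain c where c: "AE x in Lpi. h x = c" by blast
  have "LDir_graph Q C (primitive g) f"
    unfolding LDir_graph_def L2_on_iff set_integrable_Lpi AE_Lpi
  proof (intro exI conjI ballI)
    show "primitive g x = primitive g 0 + (LINT t:{0..x}|lborel. g t)" if "x \<in> {0..pi}" for x
      using that by (simp add: set_integral_primitive primitive_0)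
    show "c + primitive w x = c + primitive w 0 + (LINT t:{0..x}|lborel. w t)" if "x \<in> {0..pi}" for x
      using that by (simp add: set_integral_primitive primitive_0)
    show "AE x in Lpi. g x - Q x * primitive g x = c + primitive w x"
      using c by eventually_elim (simp add: h_def algebra_simps)
    show "AE x in Lpi. f x = - w x - Q x * g x + C * primitive g x"
      by (simp add: w_def)
  qed (simp_all add: p g w f primitive_0 primitive_pi g0)
  thus ?thesis unfolding DDir_def by blast
qed

text \<open>Both summability conditions are instances of Bessel's inequality: \<open>l2k\<close> for
  y' in the cosines, \<open>l2\<close> for \<ell>(y) in the sines.\<close>

lemma fourier_DDir:
  assumes Q: "square_integrable Lpi Q" and y: "y \<in> DDir Q C"
  shows "fourier y \<in> Ld_dom Q C"
proof -
  from y obtain f where graph: "LDir_graph Q C y f" by (auto simp: DDir_def)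
  obtain g where g: "square_integrable Lpi g" and g0: "(\<integral>x. g x \<partial>Lpi) = 0"
    and yp: "\<And>x. x \<in> {0..pi} \<Longrightarrow> y x = primitive g x" and f: "square_integrable Lpi f"
    and Ld: "fourier f = Ld Q C (fourier (primitive g))"
    using LDir_graphD[OF Q graph] by blast
  note gi = Lpi.square_integrable_integrable[OF g]
  have "fourier y = fourier (primitive g)"
    unfolding fourier_sine[abs_def]
    by (intro ext arg_cong2[where f = "(*)"] refl Bochner_Integration.integral_cong) (simp_all add: yp space_Lpi)
  moreover have "fourier (primitive g) \<in> Ld_dom Q C"
    unfolding Ld_dom_def
  proof (intro CollectI conjI allI impI)
    have "summable (\<lambda>k. (cmod (Cos.coeff g k))\<^sup>2)" by (rule Cos.bessel[OF g])
    thus "l2k (fourier (primitive g))"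
      by (simp add: l2k_def coeff_Cos_derivative[OF gi g0] norm_mult power_mult_distrib)
    show "summable (\<lambda>m. Ld_term Q (fourier (primitive g)) k (Suc m))" for k
      using Ld_sums[OF Q g g0] by (rule sums_summable)
    have "summable (\<lambda>k. (cmod (Sin.coeff f k))\<^sup>2)" by (rule Sin.bessel[OF f])
    thus "l2 (Ld Q C (fourier (primitive g)))"
      unfolding l2_def coeff_Sin Ld .
  qed
  ultimately show ?thesis by simp
qed

lemma Ld_dom_imp_DDir:
  assumes Q: "square_integrable Lpi Q" and y: "square_integrable Lpi y" and dom: "fourier y \<in> Ld_dom Q C"
  shows "\<exists>y'\<in>DDir Q C. AE x in Lpi. y x = y' x"
proof -
  define z where "z = fourier y"
  have "summable (\<lambda>k. (cmod (of_nat k * z k))\<^sup>2)"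
    using dom by (simp add: Ld_dom_def l2k_def z_def norm_mult power_mult_distrib)
  then obtain g where g: "square_integrable Lpi g"
    and lim: "(\<lambda>n. \<integral>x. (cmod (Cos.part (\<lambda>k. of_nat k * z k) n x - g x))\<^sup>2 \<partial>Lpi) \<longlonglongrightarrow> 0"
    by (rule Cos.riesz_fischer)
  have coeff: "Cos.coeff g = (\<lambda>k. of_nat k * z k)" by (rule Cos.coeff_limit[OF g lim])
  note gi = Lpi.square_integrable_integrable[OF g]
  \<comment> \<open>The prescribed coefficient of index 0 is 0 times z_0, so the primitive of g
    satisfies the Dirichlet condition at pi automatically.\<close>
  have g0: "(\<integral>x. g x \<partial>Lpi) = 0"
    using fun_cong[OF coeff, of 0] by (simp add: Cos.coeff_def cosine_def)
  have p: "square_integrable Lpi (primitive g)" by (rule square_integrable_primitive[OF gi])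
  have "of_nat k * fourier (primitive g) k = of_nat k * z k" for k
    using coeff_Cos_derivative[OF gi g0, of k] by (simp only: coeff)
  \<comment> \<open>The weight k can be cancelled for k \<ge> 1 only, which is all that completeness
    of the sines requires.\<close>
  hence "fourier (primitive g) (Suc k) = z (Suc k)" for k
    by (metis mult_left_cancel of_nat_neq_0)
  hence ae: "AE x in Lpi. y x = primitive g x"
    by (intro fourier_inject y p) (simp add: z_def)
  hence z: "z = fourier (primitive g)"
    unfolding z_def by (rule fourier_cong_AE) (use y p in \<open>simp_all add: square_integrable_def\<close>)
  have "summable (\<lambda>k. (cmod (Ld Q C z (Suc k)))\<^sup>2)"
    using dom by (simp add: Ld_dom_def l2_def z_def)
  then obtain f where f: "square_integrable Lpi f"
    and flim: "(\<lambda>n. \<integral>x. (cmod (Sin.part (\<lambda>k. Ld Q C z (Suc k)) n x - f x))\<^sup>2 \<partial>Lpi) \<longlonglongrightarrow> 0"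
    by (rule Sin.riesz_fischer)
  have "fourier f (Suc k) = Ld Q C z (Suc k)" for k
    using fun_cong[OF Sin.coeff_limit[OF f flim], of k] by (simp only: coeff_Sin)
  hence "primitive g \<in> DDir Q C"
    by (intro primitive_in_DDir[OF Q g g0 f]) (simp only: z)
  with ae show ?thesis by blast
qed

text \<open>Members of \<open>DDir\<close> are functions with boundary values, whereas sine
  coefficients determine a function only up to null sets; hence the domain equality asks for a
  representative in \<open>DDir\<close>. The operator identity is stated for coefficients, which
  determine f almost everywhere by \<open>fourier_inject\<close>.\<close>

theorem theorem16:
  fixes Q :: "real \<Rightarrow> complex" and C :: complex
  assumes periodic: "\<forall>x. Q (x + pi) = Q x"
    and meas: "Q \<in> borel_measurable lborel"
    and L2Q: "L2_on Q"
    and mean0: "(LINT x:{0..pi}|lborel. Q x) = 0"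
  shows "(\<forall>y. L2_on y \<longrightarrow>
            ((\<exists>y'\<in>DDir Q C. AE x in lborel. x \<in> {0..pi} \<longrightarrow> y x = y' x)
             \<longleftrightarrow> fourier y \<in> Ld_dom Q C))
       \<and> (\<forall>y f. LDir_graph Q C y f \<longrightarrow> fourier f = Ld Q C (fourier y))"
proof (intro conjI allI impI)
  have Q: "square_integrable Lpi Q" using L2Q by (simp add: L2_on_iff)
  show "(\<exists>y'\<in>DDir Q C. AE x in lborel. x \<in> {0..pi} \<longrightarrow> y x = y' x) \<longleftrightarrow> fourier y \<in> Ld_dom Q C"
    if "L2_on y" for y
    unfolding AE_Lpi
  proof
    have y: "square_integrable Lpi y" using that by (simp add: L2_on_iff)
    show "\<exists>y'\<in>DDir Q C. AE x in Lpi. y x = y' x" if "fourier y \<in> Ld_dom Q C"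
      by (rule Ld_dom_imp_DDir[OF Q y that])
    assume "\<exists>y'\<in>DDir Q C. AE x in Lpi. y x = y' x"
    then obtain y' where y': "y' \<in> DDir Q C" "AE x in Lpi. y x = y' x" by blast
    have "square_integrable Lpi y'"
      using y'(1) by (auto simp: DDir_def LDir_graph_def L2_on_iff)
    hence "fourier y = fourier y'"
      using y y'(2) by (intro fourier_cong_AE) (auto simp: square_integrable_def)
    thus "fourier y \<in> Ld_dom Q C" using fourier_DDir[OF Q y'(1)] by simp
  qed
  show "fourier f = Ld Q C (fourier y)" if "LDir_graph Q C y f" for y f
  proof -
    obtain g where "\<And>x. x \<in> {0..pi} \<Longrightarrow> y x = primitive g x"
      and Ld: "fourier f = Ld Q C (fourier (primitive g))"
      using LDir_graphD[OF Q \<open>LDir_graph Q C y f\<close>] by blast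
    hence "fourier y = fourier (primitive g)"
      unfolding fourier_sine[abs_def]
      by (intro ext arg_cong2[where f = "(*)"] refl Bochner_Integration.integral_cong) (simp_all add: space_Lpi)
    with Ld show ?thesis by simp
  qed
qed

end
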